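(* For all $d\geq 2$, \[ \operatorname{asdim}_{\mathrm{poly}(d)}(\mathbb{H}^d)\leq d-1. \]
   Context: $\mathbb{H}^d$ is real hyperbolic $d$-space (replaced by a maximal $1$-separated subset). $\operatorname{asdim}_{\mathrm{poly}(d)}(X)$ is the least $n$ such that for every $r\geq 0$, $X=X_0\cup\dots\cup X_n$ with each $X_i$ a disjoint union of pieces pairwise at distance at least $r$, and there is $C$ such that every ball of radius $\rho$ in every piece (with the induced metric) has cardinality at most $C\rho^d+C$. *)

theory Defs
  imports "HOL-Analysis.Analysis" "HOL-Library.Extended_Nat"
begin

text \<open>Real hyperbolic d-space, Poincare ball model: the open unit ball of R^d
  with the hyperbolic distance.\<close>

definition hyp_ball :: "(real ^ 'n) set" where
  "hyp_ball = ball 0 1"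

definition hdist :: "real ^ 'n \<Rightarrow> real ^ 'n \<Rightarrow> real" where
  "hdist x y = arcosh (1 + 2 * (norm (x - y))\<^sup>2 / ((1 - (norm x)\<^sup>2) * (1 - (norm y)\<^sup>2)))"

definition separated_set :: "('a \<Rightarrow> 'a \<Rightarrow> real) \<Rightarrow> real \<Rightarrow> 'a set \<Rightarrow> bool" where
  "separated_set dst e S \<longleftrightarrow> (\<forall>x\<in>S. \<forall>y\<in>S. x \<noteq> y \<longrightarrow> dst x y \<ge> e)"

definition maximal_separated_subset ::
    "('a \<Rightarrow> 'a \<Rightarrow> real) \<Rightarrow> real \<Rightarrow> 'a set \<Rightarrow> 'a set \<Rightarrow> bool" where
  "maximal_separated_subset dst e M S \<longleftrightarrow>
     S \<subseteq> M \<and> separated_set dst e S \<and>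
     (\<forall>T. S \<subseteq> T \<and> T \<subseteq> M \<and> separated_set dst e T \<longrightarrow> T = S)"

definition asdim_poly_witness ::
    "('a \<Rightarrow> 'a \<Rightarrow> real) \<Rightarrow> 'a set \<Rightarrow> nat \<Rightarrow> nat \<Rightarrow> bool" where
  "asdim_poly_witness dst X d n \<longleftrightarrow>
     (\<forall>r::real. r \<ge> 0 \<longrightarrow>
       (\<exists>U :: nat \<Rightarrow> 'a set set.
          X = (\<Union>i\<le>n. \<Union>(U i)) \<and>
          (\<forall>i\<le>n. \<forall>P\<in>U i. \<forall>Q\<in>U i. P \<noteq> Q \<longrightarrow>
               P \<inter> Q = {} \<and> (\<forall>x\<in>P. \<forall>y\<in>Q. dst x y \<ge> r)) \<and>
          (\<exists>C::real. \<forall>i\<le>n. \<forall>P\<in>U i. \<forall>x\<in>P. \<forall>\<rho>::real. \<rho> \<ge> 0 \<longrightarrow>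
               finite {y\<in>P. dst x y \<le> \<rho>} \<and>
               real (card {y\<in>P. dst x y \<le> \<rho>}) \<le> C * \<rho> ^ d + C)))"

definition asdim_poly :: "nat \<Rightarrow> ('a \<Rightarrow> 'a \<Rightarrow> real) \<Rightarrow> 'a set \<Rightarrow> enat" where
  "asdim_poly d dst X =
     (if \<exists>n. asdim_poly_witness dst X d n
      then enat (LEAST n. asdim_poly_witness dst X d n) else \<infinity>)"

end

theory Submission
  imports Defs
begin

text \<open>
  In half-space coordinates (X, t), work with the N-adic grids of mesh N^(-l), where N is large
  compared with the required separation r. The grid points are coloured with two colours so that,
  in each horizontal coordinate X_i separately, the piecewise linear interpolation
  f_i = f(X_i, t) of the colours is almost constant at scale r in the hyperbolic plane (X_i, t), while
  each component of f > 0 and of f < 1 meets, m levels below any given level, only O(m) grid cells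
  out of a fixed cell. Colour c (0 \<le> c < d) consists of the points for which no f_i lies in
  [c/d, (c+1)/d): there are only d - 1 horizontal coordinates, so by the pigeonhole principle every
  point gets a colour. A piece is determined by the side of the gap on which each f_i lies and by
  the component of f_i > 0 or f_i < 1 in question. A ball of radius \<rho> sees O(\<rho>) levels and O(\<rho>)
  cells per horizontal coordinate on each of them, in total O(\<rho>^d) points.
\<close>

text \<open>The obstacle is exponential growth: a grid cell contains N^m cells m levels below it, so
  a component has to stay thin. The rule "opposite to the older endpoint" ensures this. Once a point
  is old, all new points next to it get the other colour, and its component continues below it as a
  single column. A component widens only where a young point faces an older neighbour of the other
  colour, and this happens on one side only; each level thus adds a bounded number of cells. The
  colours are interpolated because sharp colour classes would touch. The sets f > 0 and f < 1
  overlap, so d gaps of width 1/d fit between their complements, and outside a gap the point lies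
  well inside the component that is recorded. Near-constancy at scale r has two sources. Vertically,
  levels are ln N apart, which is at least 5 d r. Horizontally, the height is shifted by the
  constant \<open>sigma\<close>, so that the mesh of the grid used at a point is long compared with
  exp r times the height of the point.\<close>

section \<open>A two-colouring of N-adic grids\<close>

text \<open>Names of components: the component born in the cell [P, P + 1] of level k - 1, or
  one of the components of 0 and 1, which have no top level.\<close>

datatype label = Root nat int | Ray nat

locale grid =
  fixes N :: nat
  assumes N3: "N \<ge> 3"
begin

text \<open>The colour of the point i / N^k, which does not depend on k. A point that is new on
  its level is coloured opposite to an endpoint of the parent cell, namely to the one that is
  older than the other if their ages differ.\<close>

function col :: "nat \<Rightarrow> bool" where
  "col i = (if i = 0 then False
            else if N dvd i then col (i div N)
            else \<not> col (if N dvd Suc (i div N) then Suc (i div N) else i div N))"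
  by auto
termination
proof (relation "Wellfounded.measure id", goal_cases)
  case (2 i) then show ?case using N3 by auto
next
  case (3 i)
  have "i div N \<le> i div 3" using N3 by (simp add: div_le_mono2)
  \<comment> \<open>The call at \<open>Suc (i div N)\<close> is made only if N divides that number;
    then \<open>i\<close> is at least 6, and the argument drops.\<close>
  moreover have "i div N \<ge> 2" if "N dvd Suc (i div N)"
    using dvd_imp_le[OF that] N3 by simp
  ultimately show ?case using 3 N3 by auto
qed auto

declare col.simps [simp del]

lemma col_0 [simp]: "\<not> col 0" by (simp add: col.simps)

lemma col_mult [simp]: "col (N * i) = col i"
  using N3 by (cases "i = 0") (auto simp: col.simps[of "N * i"])

lemma col_new: "\<not> N dvd i \<Longrightarrow>
  col i = (\<not> col (if N dvd Suc (i div N) then Suc (i div N) else i div N))"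
  using col.simps[of i] by (cases "i = 0") auto

lemma col_cong: "\<not> N dvd i \<Longrightarrow> \<not> N dvd j \<Longrightarrow> i div N = j div N \<Longrightarrow> col i = col j"
  by (simp add: col_new)

lemma div_Suc_new: "\<not> N dvd Suc i \<Longrightarrow> Suc i div N = i div N"
  by (simp add: div_Suc dvd_eq_mod_eq_0)

lemma col_Suc_new: "\<not> N dvd i \<Longrightarrow> \<not> N dvd Suc i \<Longrightarrow> col (Suc i) = col i"
  by (rule col_cong) (auto simp: div_Suc_new)

lemma not_both_dvd: "N dvd i \<Longrightarrow> \<not> N dvd Suc i"
  using N3 by (metis One_nat_def Suc_eq_plus1 dvd_add_right_iff nat_dvd_1_iff_1 numeral_le_one_iff semiring_norm(70))

text \<open>A new point can be connected to at most one endpoint of its parent cell, so the order of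
  the two tests in \<open>up\<close> does not matter for it.\<close>

lemma col_new_cases:
  assumes "\<not> N dvd i"
  shows "col i \<noteq> col (i div N) \<or> col i \<noteq> col (Suc (i div N))"
  using col_new[OF assms] by (auto split: if_splits)

text \<open>The point on the next coarser level to which i is connected within its colour, if any.
  A new point can only be connected to the younger endpoint of its parent cell.\<close>

definition up :: "nat \<Rightarrow> nat option" where
  "up i = (if N dvd i \<or> col i = col (i div N) then Some (i div N)
           else if col i = col (Suc (i div N)) then Some (Suc (i div N)) else None)"

lemma up_mult [simp]: "up (N * i) = Some i"
  using N3 by (auto simp: up_def)

lemma up_0 [simp]: "up 0 = Some 0" using up_mult[of 0] by simp

lemma col_1: "col (Suc 0)"
  using N3 col_new[of "Suc 0"] by auto

text \<open>By \<open>up_less\<close>, 0 and 1 are the only fixed points of \<open>up\<close>. They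
  start the two components that reach up through all levels.\<close>

lemma up_1 [simp]: "up (Suc 0) = Some (Suc 0)"
  using N3 col_1 by (auto simp: up_def)

lemma up_less:
  assumes "up i = Some j" "i \<ge> 2" shows "j < i"
proof -
  have "i div N \<le> i div 3" using N3 by (simp add: div_le_mono2)
  then show ?thesis using assms N3 by (auto simp: up_def split: if_splits)
qed

lemma col_div: "N dvd i \<Longrightarrow> col (i div N) = col i"
  using col_mult[of "i div N"] by (simp add: dvd_mult_div_cancel)

lemma up_col: "up i = Some j \<Longrightarrow> col i = col j"
  using col_div[of i] unfolding up_def by (auto split: if_splits)

text \<open>The component of the point i / N^k, found by following \<open>up\<close> to its top.
  \<open>Root\<close> stores the parent cell rather than the point, since all new points of a cell
  have the same colour and belong together. The test \<open>j < i\<close> fails only at 0 and 1;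
  \<open>Ray\<close> then omits the level, which makes the name the same on all levels.\<close>

function label :: "nat \<Rightarrow> int \<Rightarrow> label" where
  "label i k = (case up i of None \<Rightarrow> Root (i div N) k
     | Some j \<Rightarrow> if j < i then label j (k - 1) else Ray i)"
  by auto
termination by (relation "Wellfounded.measure fst") auto

declare label.simps [simp del]

lemma label_up:
  assumes "up i = Some j" shows "label i k = label j (k - 1)"
proof (cases "j < i")
  case True then show ?thesis using assms by (simp add: label.simps[of i])
next
  case False
  then have "i < 2" using up_less[OF assms] by force
  then have "i = 0 \<or> i = Suc 0" by auto
  then show ?thesis using assms by (auto simp: label.simps)
qed

lemma label_root: "up i = None \<Longrightarrow> label i k = Root (i div N) k"
  by (simp add: label.simps)

lemma label_mult: "label (N * i) k = label i (k - 1)"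
  by (rule label_up) simp

lemma up_Suc_new:
  assumes "\<not> N dvd i" "\<not> N dvd Suc i"
  shows "up (Suc i) = up i"
  using assms col_Suc_new[OF assms] div_Suc_new[OF assms(2)] by (simp add: up_def)

lemma div_before: "N dvd Suc i \<Longrightarrow> Suc i = N * Suc (i div N)"
  using N3 by (metis div_Suc dvd_eq_mod_eq_0 dvd_mult_div_cancel)

text \<open>Neighbours of equal colour have the same parent under \<open>up\<close>, or have none
  and are born in the same cell. Adjacency within a level therefore joins nothing that
  \<open>up\<close> has not already joined.\<close>

lemma label_Suc:
  assumes "col i = col (Suc i)" shows "label (Suc i) k = label i k"
proof (cases "N dvd i")
  case True
  then obtain P where P: "i = N * P" by blast
  have nd: "\<not> N dvd Suc i" by (rule not_both_dvd[OF True])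
  have "Suc i div N = P" using N3 P unfolding div_Suc_new[OF nd] by simp
  then have "up (Suc i) = Some P" using assms P by (simp add: up_def)
  then show ?thesis using P by (metis label_mult label_up)
next
  case ndi: False
  show ?thesis
  proof (cases "N dvd Suc i")
    case True
    have s: "Suc i = N * Suc (i div N)" by (rule div_before[OF True])
    then have c: "col i = col (Suc (i div N))" using assms by (metis col_mult)
    then have "up i = Some (Suc (i div N))"
      using ndi col_new_cases[OF ndi] by (auto simp: up_def)
    then show ?thesis using s by (metis label_mult label_up)
  next
    case False
    show ?thesis
    proof (cases "up i")
      case None
      then show ?thesis using up_Suc_new[OF ndi False] div_Suc_new[OF False] by (simp add: label_root)
    next
      case (Some j)
      then show ?thesis using up_Suc_new[OF ndi False] by (simp add: label_up)
    qed
  qed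
qed

text \<open>The inequalities say that the open unit interval around i, rescaled by N, meets the open
  unit interval around i'.\<close>

lemma label_step:
  assumes c: "col i' = col i" and le: "i' \<le> N * Suc i" and ge: "N * i \<le> i' + N"
  shows "label i' (k + 1) = label i k"
proof (cases "N dvd i'")
  case True
  then obtain P where P: "i' = N * P" by blast
  have "N * P \<le> N * Suc i" "N * i \<le> N * Suc P" using le ge P by auto
  then have "P \<le> Suc i" "i \<le> Suc P" using N3 by (simp_all only: mult_le_cancel1)
  then have "P = i \<or> P = Suc i \<or> i = Suc P" by auto
  moreover have "col P = col i" using c P by simp
  ultimately have "label P k = label i k" by (auto simp: label_Suc)
  then show ?thesis using P by (simp add: label_mult)
next
  case nd: False
  let ?P = "i' div N"
  \<comment> \<open>Since \<open>i'\<close> is not a multiple of N, both inequalities are strict,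
    and \<open>i\<close> must be an endpoint of the parent cell of \<open>i'\<close>.\<close>
  have "i' < N * Suc i" using le nd by (metis dvd_triv_left le_neq_implies_less)
  then have 1: "?P < Suc i" using N3 by (simp add: less_mult_imp_div_less mult.commute)
  have "N * i < i' + N" using ge nd
    by (metis dvd_add_left_iff dvd_refl dvd_triv_left le_neq_implies_less)
  also have "\<dots> < N * (?P + 2)"
    using N3 mult_div_mod_eq[of N i'] mod_less_divisor[of N i'] unfolding distrib_left by linarith
  finally have "N * i < N * (?P + 2)" .
  then have 2: "i < ?P + 2" by (simp only: mult_less_cancel1)
  have "up i' = Some i"
  proof (cases "i = ?P")
    case True then show ?thesis using c by (simp add: up_def)
  next
    case False
    then have "i = Suc ?P" using 1 2 by auto
    then show ?thesis using c nd col_new_cases[OF nd] by (auto simp: up_def)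
  qed
  then show ?thesis by (simp add: label_up)
qed

section \<open>Ancestors and the number of descendants\<close>

fun upn :: "nat \<Rightarrow> nat \<Rightarrow> nat option" where
  "upn 0 i = Some i"
| "upn (Suc m) i = Option.bind (upn m i) up"

lemma label_upn: "upn m i = Some j \<Longrightarrow> label i k = label j (k - int m)"
proof (induction m arbitrary: j)
  case (Suc m)
  then obtain j' where j': "upn m i = Some j'" "up j' = Some j"
    by (auto simp: bind_eq_Some_conv)
  show ?case using Suc.IH[OF j'(1)] label_up[OF j'(2)] by (simp add: algebra_simps)
qed auto

text \<open>If the chain of parents breaks off early, the label reveals the level and the cell of
  birth, from which the descendants can be counted instead.\<close>

lemma upn_root:
  "upn m i \<noteq> None \<or> (\<exists>b m'. m' < m \<and> upn m' i = Some b \<and> label i k = Root (b div N) (k - int m'))"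
proof (induction m)
  case (Suc m)
  show ?case
  proof (cases "upn m i")
    case None
    then show ?thesis using Suc by (auto intro: less_SucI)
  next
    case (Some b)
    show ?thesis
    proof (cases "up b")
      case None
      then have "label i k = Root (b div N) (k - int m)"
        using label_upn[OF Some, of k] label_root by simp
      then show ?thesis using Some by blast
    qed (use Some in auto)
  qed
qed auto

lemma up_dist:
  assumes "up i = Some j" shows "i < N * j + N \<and> N * j < i + N"
proof -
  define q r where "q = i div N" and "r = i mod N"
  have i: "i = N * q + r" "r < N" using N3 by (simp_all add: q_def r_def)
  have j: "j = q \<or> j = Suc q \<and> r > 0"
    using assms by (auto simp: up_def q_def r_def mod_greater_zero_iff_not_dvd split: if_splits)
  then show ?thesis
  proof
    assume "j = q" then show ?thesis using i by simp
  next
    assume "j = Suc q \<and> r > 0" then show ?thesis using i by simp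
  qed
qed

text \<open>The errors of at most N - 1 per step form the geometric sum (N - 1)(1 + ... + N^(m-1)) =
  N^m - 1. It leaves room for a further distance below 1 without exceeding one cell of the coarse
  level.\<close>

lemma upn_dist: "upn m i = Some j \<Longrightarrow> \<bar>real i - real N ^ m * real j\<bar> \<le> real N ^ m - 1"
proof (induction m arbitrary: j)
  case (Suc m)
  then obtain j' where j': "upn m i = Some j'" "up j' = Some j"
    by (auto simp: bind_eq_Some_conv)
  have "j' + 1 \<le> N * j + N" "N * j + 1 \<le> j' + N" using up_dist[OF j'(2)] by auto
  then have "real (j' + 1) \<le> real (N * j + N)" "real (N * j + 1) \<le> real (j' + N)"
    by (simp_all only: of_nat_le_iff)
  then have "\<bar>real j' - real N * real j\<bar> \<le> real N - 1" by (simp add: abs_le_iff)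
  then have "real N ^ m * \<bar>real j' - real N * real j\<bar> \<le> real N ^ m * (real N - 1)"
    by (intro mult_left_mono) auto
  moreover have "real N ^ m * \<bar>real j' - real N * real j\<bar> = \<bar>real N ^ m * real j' - real N ^ Suc m * real j\<bar>"
    by (subst (1) abs_of_nonneg[of "real N ^ m", symmetric], simp, subst abs_mult[symmetric]) (simp add: algebra_simps)
  ultimately show ?case using Suc.IH[OF j'(1)] by (simp add: algebra_simps)
qed auto

text \<open>A simple point has a single descendant on each finer level. The count of descendants is
  linear because every point has at most one child that is not simple.\<close>

definition simple :: "nat \<Rightarrow> bool" where
  "simple j \<longleftrightarrow> (\<forall>i. up i = Some j \<longrightarrow> i = N * j)"

text \<open>A child other than \<open>N * j\<close> is new, so it is opposite in colour to the
  endpoint chosen by \<open>col\<close>, which thus is not \<open>j\<close>. If both endpoints were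
  new, they would have the same colour; hence the other endpoint is old and of the other
  colour.\<close>

lemma up_new:
  assumes "up i = Some j" "i \<noteq> N * j"
  shows "\<not> N dvd i \<and> \<not> N dvd j \<and> col i = col j \<and>
    (i div N = j \<and> N dvd Suc j \<and> col (Suc j) \<noteq> col j \<or> j = Suc (i div N) \<and> N dvd (j - 1) \<and> col (j - 1) \<noteq> col j)"
proof -
  have nd: "\<not> N dvd i" using assms by (auto simp: up_def)
  have c: "col i = col j" using assms(1) by (rule up_col)
  have "j = i div N \<or> j = Suc (i div N)" using assms(1) by (auto simp: up_def split: if_splits)
  then show ?thesis
  proof
    assume j: "j = i div N"
    then have "N dvd Suc j" "col (Suc j) \<noteq> col j" using c col_new[OF nd] by (auto split: if_splits)
    then show ?thesis using nd c j not_both_dvd by blast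
  next
    assume j: "j = Suc (i div N)"
    then have 1: "\<not> N dvd j" "col (i div N) \<noteq> col j" using c col_new[OF nd] by (auto split: if_splits)
    then have "N dvd i div N" using col_Suc_new[of "i div N"] j by auto
    then show ?thesis using nd c j 1 by simp
  qed
qed

text \<open>Simplicity is inherited: by \<open>up_new\<close>, the multiple \<open>N * j\<close> has
  no child other than its own copy.\<close>

lemma upn_simple: "simple j \<Longrightarrow> upn m i = Some j \<Longrightarrow> i = N ^ m * j"
proof (induction m arbitrary: j)
  case (Suc m)
  then obtain j' where j': "upn m i = Some j'" "up j' = Some j"
    by (auto simp: bind_eq_Some_conv)
  have e: "j' = N * j" using Suc.prems(1) j'(2) unfolding simple_def by blast
  have "simple j'" unfolding simple_def using up_new e by (metis dvd_triv_left)
  from Suc.IH[OF this j'(1)] show ?case by (simp add: e)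
qed auto

lemma not_simple:
  assumes "\<not> simple j"
  shows "\<not> N dvd j" "N dvd Suc j \<and> col (Suc j) \<noteq> col j \<or> N dvd (j - 1) \<and> col (j - 1) \<noteq> col j"
  using assms up_new unfolding simple_def by blast+

definition pre :: "nat \<Rightarrow> nat set" where "pre j = {i. up i = Some j}"

text \<open>For N = 2 a new point would have old neighbours on both sides and could branch towards
  both.\<close>

lemma dvd_two: "\<not> N dvd j \<Longrightarrow> N dvd Suc j \<Longrightarrow> N dvd j - 1 \<Longrightarrow> False"
proof -
  assume a: "\<not> N dvd j" "N dvd Suc j" "N dvd j - 1"
  then have "j > 0" by (metis dvd_0_right gr0I)
  then have "Suc j = (j - 1) + 2" by simp
  then have "N dvd 2" using a by (metis dvd_add_right_iff)
  then show False using N3 by (auto dest: dvd_imp_le)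
qed

text \<open>The disjuncts tell on which side of \<open>j\<close> new children may lie. They fill the
  cell between \<open>j\<close> and an old neighbour of the other colour and all have the colour of
  \<open>j\<close>. A child that is not simple has an old neighbour of the other colour too, which
  leaves only the child at the far end of the cell.\<close>

lemma pre_bound:
  "pre j \<subseteq> insert (N * j) {N * j + 1..<N * Suc j} \<and> (\<forall>i\<in>pre j. \<not> simple i \<longrightarrow> i = N * Suc j - 1) \<or>
   pre j \<subseteq> insert (N * j) {N * (j - 1) + 1..<N * j} \<and> (\<forall>i\<in>pre j. \<not> simple i \<longrightarrow> i = N * (j - 1) + 1)"
proof -
  have loc: "N * (i div N) + 1 \<le> i \<and> i < N * Suc (i div N)" if "\<not> N dvd i" for i
  proof -
    have "i mod N > 0" "i mod N < N" using that N3 by (auto simp: mod_greater_zero_iff_not_dvd)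
    then show ?thesis using mult_div_mod_eq[of N i] unfolding mult_Suc_right by linarith
  qed
  have nxt: "Suc i = N * Suc (i div N)" if "N dvd Suc i" for i
    by (rule div_before[OF that])
  have prv: "i = N * (i div N) + 1" if d: "N dvd i - 1" "\<not> N dvd i" for i
  proof -
    obtain q where q: "i - 1 = N * q" using d(1) by blast
    have "i > 0" using d by (metis dvd_0_right gr0I)
    then have i: "i = N * q + 1" using q by simp
    then have "i div N = q" using N3 d(2) div_Suc_new[of "N * q"] by simp
    then show ?thesis using i by simp
  qed
  have sd: "simple (N * j)" using not_simple(1) dvd_triv_left by blast
  show ?thesis
  proof (cases "N dvd Suc j \<and> \<not> N dvd j")
    case True
    have d: "i = N * j \<or> (\<not> N dvd i \<and> i div N = j \<and> col i = col j \<and> col (Suc j) \<noteq> col j)" if "i \<in> pre j" for i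
    proof (cases "i = N * j")
      case False
      have "up i = Some j" using that by (simp add: pre_def)
      from up_new[OF this False] dvd_two[of j] True show ?thesis by argo
    qed simp
    have "pre j \<subseteq> insert (N * j) {N * j + 1..<N * Suc j}"
    proof
      fix i assume "i \<in> pre j"
      from d[OF this] loc[of i] show "i \<in> insert (N * j) {N * j + 1..<N * Suc j}" by auto
    qed
    moreover have "i = N * Suc j - 1" if i: "i \<in> pre j" "\<not> simple i" for i
    proof -
      have f: "\<not> N dvd i" "i div N = j" "col i = col j" using d i sd by auto
      consider "N dvd Suc i" | "N dvd (i - 1)" "col (i - 1) \<noteq> col i" using not_simple(2)[OF i(2)] by blast
      then show ?thesis
      proof cases
        case 1 then show ?thesis using nxt[OF 1] f by simp
      next
        case 2 then show ?thesis using prv[OF 2(1) f(1)] f by simp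
      qed
    qed
    ultimately show ?thesis by blast
  next
    case False
    have d: "i = N * j \<or> (\<not> N dvd i \<and> j = Suc (i div N) \<and> col i = col j)" if "i \<in> pre j" for i
    proof (cases "i = N * j")
      case ne: False
      have "up i = Some j" using that by (simp add: pre_def)
      from up_new[OF this ne] False show ?thesis by argo
    qed simp
    have "pre j \<subseteq> insert (N * j) {N * (j - 1) + 1..<N * j}"
    proof
      fix i assume "i \<in> pre j"
      from d[OF this] loc[of i] show "i \<in> insert (N * j) {N * (j - 1) + 1..<N * j}" by auto
    qed
    moreover have "i = N * (j - 1) + 1" if i: "i \<in> pre j" "\<not> simple i" for i
    proof -
      have f: "\<not> N dvd i" "j = Suc (i div N)" "col i = col j" using d i sd by auto
      consider "N dvd Suc i" "col (Suc i) \<noteq> col i" | "N dvd (i - 1)" using not_simple(2)[OF i(2)] by blast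
      then show ?thesis
      proof cases
        case 1 
        have "col (Suc i) = col j" unfolding nxt[OF 1(1)] f(2) by (rule col_mult)
        then show ?thesis using 1(2) f(3) by simp
      next
        case 2 then show ?thesis using prv[OF 2 f(1)] f by simp
      qed
    qed
    ultimately show ?thesis by blast
  qed
qed

lemma card_pre:
  "finite (pre j) \<and> card (pre j) \<le> N \<and> (\<exists>e. \<forall>i\<in>pre j. \<not> simple i \<longrightarrow> i = e)"
proof -
  have 1: "card (insert (N * j) {N * j + 1..<N * Suc j}) \<le> N"
    using N3 by (simp add: card_insert_if)
  have 2: "card (insert (N * j) {N * (j - 1) + 1..<N * j}) \<le> N"
    using N3 by (cases j) (simp_all add: card_insert_if)
  show ?thesis using pre_bound[of j]
  proof
    assume a: "pre j \<subseteq> insert (N * j) {N * j + 1..<N * Suc j} \<and> (\<forall>i\<in>pre j. \<not> simple i \<longrightarrow> i = N * Suc j - 1)"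
    then have "finite (pre j)" "card (pre j) \<le> N"
      using 1 by (auto intro: finite_subset order_trans[OF card_mono])
    then show ?thesis using a by blast
  next
    assume a: "pre j \<subseteq> insert (N * j) {N * (j - 1) + 1..<N * j} \<and> (\<forall>i\<in>pre j. \<not> simple i \<longrightarrow> i = N * (j - 1) + 1)"
    then have "finite (pre j)" "card (pre j) \<le> N"
      using 2 by (auto intro: finite_subset order_trans[OF card_mono])
    then show ?thesis using a by blast
  qed
qed

lemma card_upn: "finite {i. upn m i = Some j} \<and> card {i. upn m i = Some j} \<le> 1 + N * m"
proof (induction m arbitrary: j)
  case (Suc m)
  have eq: "{i. upn (Suc m) i = Some j} = (\<Union>j'\<in>pre j. {i. upn m i = Some j'})"
    by (auto simp: pre_def bind_eq_Some_conv)
  obtain e where e: "\<forall>i\<in>pre j. \<not> simple i \<longrightarrow> i = e" using card_pre by blast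
  have fin: "finite (pre j)" and cN: "card (pre j) \<le> N" using card_pre by auto
  \<comment> \<open>Only the exceptional child \<open>e\<close> needs the induction hypothesis; the
    others contribute one descendant each.\<close>
  have 1: "card {i. upn m i = Some j'} \<le> 1 + (if j' = e then N * m else 0)" if "j' \<in> pre j" for j'
  proof (cases "simple j'")
    case True
    then have "{i. upn m i = Some j'} \<subseteq> {N ^ m * j'}" using upn_simple by auto
    from card_mono[OF _ this] show ?thesis by simp
  next
    case False
    then show ?thesis using e that Suc.IH[of j'] by auto
  qed
  have "card {i. upn (Suc m) i = Some j} \<le> (\<Sum>j'\<in>pre j. card {i. upn m i = Some j'})"
    unfolding eq by (rule card_UN_le[OF fin])
  also have "\<dots> \<le> (\<Sum>j'\<in>pre j. 1 + (if j' = e then N * m else 0))"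
    by (rule sum_mono[OF 1])
  also have "\<dots> = card (pre j) + (if e \<in> pre j then N * m else 0)"
    using fin by (simp add: sum.distrib sum_Suc del: One_nat_def)
  also have "\<dots> \<le> 1 + N * Suc m" using cN by auto
  finally show ?case using Suc.IH fin eq by auto
qed auto

end

section \<open>Interpolating the colouring\<close>

definition interp :: "(int \<Rightarrow> real) \<Rightarrow> real \<Rightarrow> real" where
  "interp c x = (1 - frac x) * c \<lfloor>x\<rfloor> + frac x * c (\<lfloor>x\<rfloor> + 1)"

lemma interp_bounds:
  assumes "\<And>p. 0 \<le> c p" "\<And>p. c p \<le> 1" shows "0 \<le> interp c x" "interp c x \<le> 1"
proof -
  have f: "0 \<le> frac x" "frac x \<le> 1" using frac_lt_1[of x] by (auto intro: less_imp_le)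
  show "0 \<le> interp c x" unfolding interp_def using f assms by (intro add_nonneg_nonneg mult_nonneg_nonneg) auto
  have "interp c x \<le> (1 - frac x) * 1 + frac x * 1" unfolding interp_def
    using f assms by (intro add_mono mult_left_mono) auto
  then show "interp c x \<le> 1" by simp
qed

lemma interp_compl: "interp (\<lambda>p. 1 - c p) x = 1 - interp c x"
  by (simp add: interp_def algebra_simps)

lemma interp_lip_le:
  assumes c: "\<And>p. \<bar>c (p + 1) - c p\<bar> \<le> 1" and xy: "x \<le> y" "y - x < 1"
  shows "\<bar>interp c x - interp c y\<bar> \<le> y - x"
proof (cases "\<lfloor>x\<rfloor> = \<lfloor>y\<rfloor>")
  case True
  have "interp c x - interp c y = - ((y - x) * (c (\<lfloor>x\<rfloor> + 1) - c \<lfloor>x\<rfloor>))"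
    using True by (simp add: interp_def frac_def algebra_simps)
  then have "\<bar>interp c x - interp c y\<bar> = (y - x) * \<bar>c (\<lfloor>x\<rfloor> + 1) - c \<lfloor>x\<rfloor>\<bar>"
    using xy by (simp add: abs_mult)
  also have "\<dots> \<le> (y - x) * 1" using c xy by (intro mult_left_mono) auto
  finally show ?thesis by simp
next
  case False
  \<comment> \<open>Exactly one breakpoint separates x from y; the difference is split
    there.\<close>
  have "\<lfloor>y\<rfloor> = \<lfloor>x\<rfloor> + 1" using False xy by linarith
  then have fy: "\<lfloor>y\<rfloor> = \<lfloor>x\<rfloor> + 1" "frac y = y - (real_of_int \<lfloor>x\<rfloor> + 1)" by (simp_all add: frac_def)
  let ?p = "\<lfloor>x\<rfloor>"
  have "interp c x - interp c y = - ((1 - frac x) * (c (?p + 1) - c ?p)) - frac y * (c (?p + 1 + 1) - c (?p + 1))"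
    by (simp add: interp_def fy(1) algebra_simps)
  then have "\<bar>interp c x - interp c y\<bar> \<le> \<bar>(1 - frac x) * (c (?p + 1) - c ?p)\<bar> + \<bar>frac y * (c (?p + 1 + 1) - c (?p + 1))\<bar>"
    by linarith
  also have "\<dots> \<le> (1 - frac x) * 1 + frac y * 1"
    unfolding abs_mult using c[of ?p] c[of "?p + 1"] frac_lt_1[of x] frac_ge_0[of x] frac_ge_0[of y]
    by (intro add_mono mult_mono) auto
  also have "\<dots> = y - x" using fy(2) by (simp add: frac_def)
  finally show ?thesis .
qed

lemma interp_lip:
  assumes "\<And>p. \<bar>c (p + 1) - c p\<bar> \<le> 1" "\<bar>x - y\<bar> < 1"
  shows "\<bar>interp c x - interp c y\<bar> \<le> \<bar>x - y\<bar>"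
  using interp_lip_le[of c x y] interp_lip_le[of c y x] assms by (cases "x \<le> y") auto

lemma interp_diff:
  assumes "\<bar>c \<lfloor>x\<rfloor> - c' \<lfloor>x\<rfloor>\<bar> \<le> e" "\<bar>c (\<lfloor>x\<rfloor> + 1) - c' (\<lfloor>x\<rfloor> + 1)\<bar> \<le> e"
  shows "\<bar>interp c x - interp c' x\<bar> \<le> e"
proof -
  let ?p = "\<lfloor>x\<rfloor>"
  have "interp c x - interp c' x = (1 - frac x) * (c ?p - c' ?p) + frac x * (c (?p + 1) - c' (?p + 1))"
    by (simp add: interp_def algebra_simps)
  then have "\<bar>interp c x - interp c' x\<bar> \<le> \<bar>(1 - frac x) * (c ?p - c' ?p)\<bar> + \<bar>frac x * (c (?p + 1) - c' (?p + 1))\<bar>"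
    by linarith
  also have "\<dots> \<le> (1 - frac x) * e + frac x * e"
    unfolding abs_mult using assms frac_lt_1[of x] frac_ge_0[of x]
    by (intro add_mono mult_mono) auto
  also have "\<dots> = e" by (simp add: algebra_simps)
  finally show ?thesis .
qed

text \<open>One of the two summands is at least w / 2. Its factors lie in [0, 1], so each of them is
  at least w / 2: one factor bounds the distance to \<open>p\<close>, the other the value
  there.\<close>

lemma interp_large:
  assumes "\<And>p. 0 \<le> c p" "\<And>p. c p \<le> 1" "interp c x \<ge> w"
  obtains p where "\<bar>x - of_int p\<bar> \<le> 1 - w / 2" "c p \<ge> w / 2"
proof -
  have f: "0 \<le> frac x" "frac x \<le> 1" using frac_lt_1[of x] by (auto intro: less_imp_le)
  have *: "a \<ge> w / 2 \<and> b \<ge> w / 2" if "a * b \<ge> w / 2" "0 \<le> a" "a \<le> 1" "0 \<le> b" "b \<le> 1" for a b :: real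
    using that mult_left_le[of b a] mult_left_le_one_le[of b a] by linarith
  have "(1 - frac x) * c \<lfloor>x\<rfloor> \<ge> w / 2 \<or> frac x * c (\<lfloor>x\<rfloor> + 1) \<ge> w / 2"
    using assms(3) unfolding interp_def by linarith
  then show thesis
  proof
    assume "(1 - frac x) * c \<lfloor>x\<rfloor> \<ge> w / 2"
    from *[OF this] f assms show thesis by (intro that[of "\<lfloor>x\<rfloor>"]) (auto simp: frac_def)
  next
    assume "frac x * c (\<lfloor>x\<rfloor> + 1) \<ge> w / 2"
    from *[OF this] f assms show thesis by (intro that[of "\<lfloor>x\<rfloor> + 1"]) (auto simp: frac_def)
  qed
qed

lemma card_floor_interval:
  fixes u v :: real assumes "u \<le> v"
  shows "real (card {\<lfloor>u\<rfloor>..\<lfloor>v\<rfloor>}) \<le> v - u + 2"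
proof -
  have "\<lfloor>u\<rfloor> \<le> \<lfloor>v\<rfloor>" using assms by (rule floor_mono)
  then have "real (card {\<lfloor>u\<rfloor>..\<lfloor>v\<rfloor>}) = of_int (\<lfloor>v\<rfloor> - \<lfloor>u\<rfloor> + 1)" by simp
  then show ?thesis by linarith
qed

lemma abs_diff_scale:
  fixes a b s :: real assumes "s > 0" shows "\<bar>a * s - b * s\<bar> = \<bar>a - b\<bar> * s"
  using assms by (simp add: abs_mult flip: left_diff_distrib)

section \<open>Weights and components in the hyperbolic half-plane\<close>

context grid
begin

text \<open>The half-plane coordinates are X and the negative logarithm \<tau> of the height to the base N.
  Taking the absolute value of X makes natural numbers sufficient for the grid.\<close>

definition active :: "bool \<Rightarrow> real \<Rightarrow> real \<Rightarrow> int \<Rightarrow> nat \<Rightarrow> bool" where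
  "active b X \<tau> l i \<longleftrightarrow>
     \<bar>\<tau> - of_int l\<bar> < 1 \<and> \<bar>\<bar>X\<bar> * real N powi l - real i\<bar> < 1 \<and> col i = b"

text \<open>For b = True this is the function f of the overview: linear in the position on each
  grid, then linear between two consecutive levels. Only nonnegative \<open>p\<close> are evaluated,
  so \<open>nat p\<close> loses nothing.\<close>

definition weight :: "bool \<Rightarrow> real \<Rightarrow> real \<Rightarrow> real" where
  "weight b X \<tau> = interp (\<lambda>l. interp (\<lambda>p. of_bool (col (nat p) = b)) (\<bar>X\<bar> * real N powi l)) \<tau>"

lemma N_pos: "real N > 0" "real N \<ge> 3" "real N \<noteq> 0" using N3 by auto

lemma scale_pos [simp]: "real N powi l > 0" using N_pos by (simp add: zero_less_power_int)

lemma scale_Suc: "real N powi (l + 1) = real N * real N powi l"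
  using N_pos by (simp add: power_int_add_1')

lemma weight_not: "weight (\<not> b) X \<tau> = 1 - weight b X \<tau>"
proof -
  have "(\<lambda>p. of_bool (col (nat p) = (\<not> b)) :: real) = (\<lambda>p. 1 - of_bool (col (nat p) = b))" by auto
  then show ?thesis unfolding weight_def by (simp only: interp_compl)
qed

lemma abs_abs_diff_scale:
  "\<bar>\<bar>X\<bar> * real N powi l - \<bar>Y\<bar> * real N powi l\<bar> \<le> \<bar>X - Y\<bar> * real N powi l"
  unfolding abs_diff_scale[OF scale_pos]
  by (rule mult_right_mono[OF abs_triangle_ineq3 less_imp_le[OF scale_pos]])

lemma scale_mono: "l \<le> l' \<Longrightarrow> real N powi l \<le> real N powi l'"
  using N_pos(2) by (intro power_int_increasing) simp_all

text \<open>First \<tau> moves with X fixed, then X moves with \<tau>' fixed. In the second move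
  only the levels up to \<lfloor>\<tau>'\<rfloor> + 1 enter, and the bound on the finest of them
  covers the other.\<close>

lemma weight_lip:
  assumes \<tau>: "\<bar>\<tau> - \<tau>'\<bar> \<le> e" and XY: "\<bar>X - Y\<bar> * real N powi (\<lfloor>\<tau>'\<rfloor> + 1) \<le> e" and e: "e < 1"
  shows "\<bar>weight b X \<tau> - weight b Y \<tau>'\<bar> \<le> 2 * e"
proof -
  define c where "c = (\<lambda>p. of_bool (col (nat p) = b) :: real)"
  define G where "G = (\<lambda>X l. interp c (\<bar>X\<bar> * real N powi l))"
  have c01: "0 \<le> c p" "c p \<le> 1" for p by (simp_all add: c_def)
  have G01: "0 \<le> G X l" "G X l \<le> 1" for X l
    unfolding G_def by (rule interp_bounds, rule c01, rule c01)+
  have w: "weight b X \<tau> = interp (G X) \<tau>" for X \<tau> by (simp add: weight_def G_def c_def)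
  have 1: "\<bar>interp (G X) \<tau> - interp (G X) \<tau>'\<bar> \<le> \<bar>\<tau> - \<tau>'\<bar>"
  proof (rule interp_lip)
    show "\<bar>G X (p + 1) - G X p\<bar> \<le> 1" for p
      using G01[of X p] G01[of X "p + 1"] by linarith
  qed (use \<tau> e in linarith)
  have d: "\<bar>G X l - G Y l\<bar> \<le> e" if "l \<le> \<lfloor>\<tau>'\<rfloor> + 1" for l
  proof -
    have "\<bar>X - Y\<bar> * real N powi l \<le> \<bar>X - Y\<bar> * real N powi (\<lfloor>\<tau>'\<rfloor> + 1)"
      by (rule mult_left_mono[OF scale_mono[OF that] abs_ge_zero])
    then have *: "\<bar>\<bar>X\<bar> * real N powi l - \<bar>Y\<bar> * real N powi l\<bar> \<le> e"
      using abs_abs_diff_scale[of X l Y] XY by linarith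
    show ?thesis unfolding G_def
    proof (rule order_trans[OF interp_lip *])
      show "\<bar>\<bar>X\<bar> * real N powi l - \<bar>Y\<bar> * real N powi l\<bar> < 1" using * e by linarith
      show "\<bar>c (p + 1) - c p\<bar> \<le> 1" for p using c01[of p] c01[of "p + 1"] by linarith
    qed
  qed
  have 2: "\<bar>interp (G X) \<tau>' - interp (G Y) \<tau>'\<bar> \<le> e"
    by (rule interp_diff; rule d) simp_all
  show ?thesis unfolding w using 1 2 \<tau> by linarith
qed

lemma label_level:
  assumes "\<bar>z - real i\<bar> < 1" "\<bar>z - real j\<bar> < 1" "col i = col j"
  shows "label i l = label j l"
proof -
  have "i = j \<or> i = Suc j \<or> j = Suc i" using assms(1,2) by linarith
  then show ?thesis
  proof (elim disjE)
    assume "i = Suc j" then show ?thesis using assms(3) label_Suc[of j l] by simp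
  next
    assume "j = Suc i" then show ?thesis using assms(3) label_Suc[of i l] by simp
  qed simp
qed

lemma active_next:
  assumes "active b X \<tau> l i" "active b X \<tau> (l + 1) i'"
  shows "label i l = label i' (l + 1)"
proof -
  define z where "z = \<bar>X\<bar> * real N powi l"
  have a: "\<bar>z - real i\<bar> < 1" "\<bar>real N * z - real i'\<bar> < 1" "col i = b" "col i' = b"
    using assms by (auto simp: active_def z_def scale_Suc mult_ac)
  have "\<bar>real N * z - real N * real i\<bar> < real N"
    using a(1) N_pos by (simp add: right_diff_distrib[symmetric] abs_mult)
  then have "real i' < real (N * i + N) + 1" "real (N * i) < real (i' + N) + 1"
    using a(2) by simp_all
  then have "i' \<le> N * i + N" "N * i \<le> i' + N" by linarith+
  then show ?thesis using a label_step[of i' i l] by simp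
qed

lemma active_unique:
  assumes "active b X \<tau> l i" "active b X \<tau> l' i'" shows "label i l = label i' l'"
proof -
  have "l = l' \<or> l' = l + 1 \<or> l = l' + 1" using assms unfolding active_def by linarith
  then show ?thesis
  proof (elim disjE)
    assume "l = l'"
    then show ?thesis using assms label_level[of "\<bar>X\<bar> * real N powi l" i i' l]
      unfolding active_def by simp
  next
    assume "l' = l + 1" then show ?thesis using assms active_next by simp
  next
    assume "l = l' + 1" then show ?thesis using assms active_next[of b X \<tau> l' i' i] by simp
  qed
qed

text \<open>Well defined by \<open>active_unique\<close> wherever some grid point is active, in
  particular where the weight is positive; elsewhere the value is arbitrary.\<close>

definition lab :: "bool \<Rightarrow> real \<Rightarrow> real \<Rightarrow> label" where
  "lab b X \<tau> = (THE c. \<exists>l i. active b X \<tau> l i \<and> c = label i l)"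

lemma lab_eq:
  assumes "active b X \<tau> l i" shows "lab b X \<tau> = label i l"
  unfolding lab_def
proof (rule the_equality)
  show "\<exists>l' i'. active b X \<tau> l' i' \<and> label i l = label i' l'"
    by (intro exI conjI, rule assms, rule refl)
  show "c = label i l" if "\<exists>l i. active b X \<tau> l i \<and> c = label i l" for c
    using that by (elim exE conjE) (simp only: active_unique[OF assms])
qed

text \<open>\<open>interp_large\<close> is applied twice, to the level and then to the position,
  each time halving w. The margin w / 4 is what \<open>lab_near\<close> uses up.\<close>

lemma active_exists:
  assumes "weight b X \<tau> \<ge> w" "w > 0"
  obtains l i where "\<bar>\<tau> - of_int l\<bar> \<le> 1 - w / 4" "\<bar>\<bar>X\<bar> * real N powi l - real i\<bar> \<le> 1 - w / 4" "col i = b"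
proof -
  define c where "c = (\<lambda>p. of_bool (col (nat p) = b) :: real)"
  define G where "G = (\<lambda>l. interp c (\<bar>X\<bar> * real N powi l))"
  have c01: "0 \<le> c p" "c p \<le> 1" for p by (simp_all add: c_def)
  have G01: "0 \<le> G l" "G l \<le> 1" for l
    unfolding G_def by (rule interp_bounds, rule c01, rule c01)+
  have w: "interp G \<tau> \<ge> w" using assms(1) by (simp add: weight_def G_def c_def)
  obtain l where l: "\<bar>\<tau> - of_int l\<bar> \<le> 1 - w / 2" "G l \<ge> w / 2"
    by (rule interp_large[OF G01 w])
  obtain p where p: "\<bar>\<bar>X\<bar> * real N powi l - of_int p\<bar> \<le> 1 - w / 2 / 2" "c p \<ge> w / 2 / 2"
    by (rule interp_large[OF c01 l(2)[unfolded G_def]])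
  have "\<bar>X\<bar> * real N powi l \<ge> 0" by (rule mult_nonneg_nonneg[OF abs_ge_zero less_imp_le[OF scale_pos]])
  then have "p > -1" using p(1) assms(2) by linarith
  then have np: "real (nat p) = of_int p" by simp
  have cp: "col (nat p) = b" by (rule ccontr) (use p(2) assms(2) in \<open>simp add: c_def\<close>)
  show thesis
    by (rule that[OF _ _ cp, of l]; use l(1) p(1) np assms(2) in linarith)
qed

lemma active_exists_pos:
  assumes "weight b X \<tau> > 0" obtains l i where "active b X \<tau> l i"
proof -
  obtain l i where "\<bar>\<tau> - of_int l\<bar> \<le> 1 - weight b X \<tau> / 4"
    "\<bar>\<bar>X\<bar> * real N powi l - real i\<bar> \<le> 1 - weight b X \<tau> / 4" "col i = b"
    by (rule active_exists[OF order_refl assms])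
  then show thesis using assms by (intro that[of l i]) (simp add: active_def)
qed

text \<open>A grid point that is active with margin w / 4 at the first point remains active at the
  second, so both read off the same label.\<close>

lemma lab_near:
  assumes w: "weight b X \<tau> \<ge> w" "w > 0" and \<tau>: "\<bar>\<tau> - \<tau>'\<bar> < w / 4"
    and XY: "\<bar>X - Y\<bar> * real N powi (\<lfloor>\<tau>\<rfloor> + 1) < w / 4"
  shows "lab b X \<tau> = lab b Y \<tau>'"
proof -
  obtain l i where li: "\<bar>\<tau> - of_int l\<bar> \<le> 1 - w / 4" "\<bar>\<bar>X\<bar> * real N powi l - real i\<bar> \<le> 1 - w / 4" "col i = b"
    by (rule active_exists[OF w])
  have 1: "active b X \<tau> l i" unfolding active_def
    by (intro conjI li(3); use li(1,2) w(2) in linarith)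
  have "l \<le> \<lfloor>\<tau>\<rfloor> + 1" using li(1) w(2) by linarith
  then have "\<bar>X - Y\<bar> * real N powi l \<le> \<bar>X - Y\<bar> * real N powi (\<lfloor>\<tau>\<rfloor> + 1)"
    by (intro mult_left_mono scale_mono abs_ge_zero)
  then have "\<bar>\<bar>X\<bar> * real N powi l - \<bar>Y\<bar> * real N powi l\<bar> < w / 4"
    using XY abs_abs_diff_scale[of X l Y] by linarith
  then have "active b Y \<tau>' l i" unfolding active_def
    by (intro conjI li(3); use li(1,2) \<tau> in linarith)
  then show ?thesis using lab_eq[OF 1] lab_eq by simp
qed

text \<open>If the m-th ancestor of \<open>i\<close> exists, it is one of 8 integers near
  \<open>z\<close>. Otherwise the component was born fewer than m levels up, in a cell determined by
  \<open>c\<close>, which leaves N possible ancestors. Each ancestor has at most 1 + N m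
  descendants.\<close>

lemma card_label_set:
  "finite {i. label i l = c \<and> (\<forall>j. upn m i = Some j \<longrightarrow> \<bar>z - real j\<bar> < 3)} \<and>
    card {i. label i l = c \<and> (\<forall>j. upn m i = Some j \<longrightarrow> \<bar>z - real j\<bar> < 3)} \<le> (N + 8) * (1 + N * m)"
proof -
  let ?A = "{i. label i l = c \<and> (\<forall>j. upn m i = Some j \<longrightarrow> \<bar>z - real j\<bar> < 3)}"
  define J where "J = nat ` {\<lfloor>z\<rfloor> - 3..\<lfloor>z\<rfloor> + 4}"
  define R where "R = (\<lambda>P. {N * P..<N * P + N})"
  \<comment> \<open>A label names at most one cell and level of birth. If it names none in range,
    the second condition is vacuous and any values will do.\<close>
  obtain P m' where Pm: "m' \<le> m"
    "\<And>i b m''. m'' < m \<Longrightarrow> c = Root (b div N) (l - int m'') \<Longrightarrow> m'' = m' \<and> b \<in> R P"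
  proof (cases "\<exists>P m''. m'' < m \<and> c = Root P (l - int m'')")
    case True
    then obtain P m'' where "m'' < m" "c = Root P (l - int m'')" by blast
    moreover have "b \<in> R (b div N)" for b
    proof -
      have "b mod N < N" "b = N * (b div N) + b mod N" using N3 by auto
      then show ?thesis unfolding R_def atLeastLessThan_iff by linarith
    qed
    ultimately show thesis by (intro that[of m'' P]) auto
  next
    case False then show thesis by (intro that[of m 0]) auto
  qed
  have sub: "?A \<subseteq> (\<Union>j\<in>J. {i. upn m i = Some j}) \<union> (\<Union>b\<in>R P. {i. upn m' i = Some b})"
  proof
    fix i assume i: "i \<in> ?A"
    show "i \<in> (\<Union>j\<in>J. {i. upn m i = Some j}) \<union> (\<Union>b\<in>R P. {i. upn m' i = Some b})"
    proof (cases "upn m i")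
      case (Some j)
      then have "\<bar>z - real j\<bar> < 3" using i by blast
      then have "int j \<in> {\<lfloor>z\<rfloor> - 3..\<lfloor>z\<rfloor> + 4}" by (simp add: abs_less_iff) linarith
      then have "j \<in> J" unfolding J_def by (metis image_eqI nat_int)
      then show ?thesis using Some by blast
    next
      case None
      then obtain b m'' where b: "m'' < m" "upn m'' i = Some b" "label i l = Root (b div N) (l - int m'')"
        using upn_root[of m i l] by auto
      have "c = Root (b div N) (l - int m'')" using i b(3) by simp
      from Pm(2)[OF b(1) this] b(2) show ?thesis by (intro UnI2 UN_I[of b]) auto
    qed
  qed
  have cJ: "finite J" "card J \<le> 8" unfolding J_def using card_image_le[of "{\<lfloor>z\<rfloor> - 3..\<lfloor>z\<rfloor> + 4}" nat] by auto
  have cR: "finite (R P)" "card (R P) = N" unfolding R_def by auto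
  have 1: "card (\<Union>j\<in>J. {i. upn m i = Some j}) \<le> 8 * (1 + N * m)"
  proof -
    have "card (\<Union>j\<in>J. {i. upn m i = Some j}) \<le> (\<Sum>j\<in>J. 1 + N * m)"
      using card_upn by (intro order_trans[OF card_UN_le[OF cJ(1)] sum_mono]) auto
    also have "\<dots> = card J * (1 + N * m)" by simp
    also have "\<dots> \<le> 8 * (1 + N * m)" using cJ(2) by (rule mult_le_mono1)
    finally show ?thesis .
  qed
  have 2: "card (\<Union>b\<in>R P. {i. upn m' i = Some b}) \<le> N * (1 + N * m)"
  proof -
    have "card (\<Union>b\<in>R P. {i. upn m' i = Some b}) \<le> (\<Sum>b\<in>R P. 1 + N * m')"
      using card_upn by (intro order_trans[OF card_UN_le[OF cR(1)] sum_mono]) auto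
    also have "\<dots> \<le> N * (1 + N * m)" using cR Pm(1) by simp
    finally show ?thesis .
  qed
  have f: "finite ((\<Union>j\<in>J. {i. upn m i = Some j}) \<union> (\<Union>b\<in>R P. {i. upn m' i = Some b}))"
    using card_upn cJ cR by auto
  have "card ?A \<le> card ((\<Union>j\<in>J. {i. upn m i = Some j}) \<union> (\<Union>b\<in>R P. {i. upn m' i = Some b}))"
    by (rule card_mono[OF f sub])
  also have "\<dots> \<le> 8 * (1 + N * m) + N * (1 + N * m)"
    using 1 2 by (intro order_trans[OF card_Un_le]) linarith
  finally show ?thesis using finite_subset[OF sub f] by (simp add: algebra_simps)
qed

text \<open>Linear growth in one horizontal coordinate: K is a level on whose grid the ball is about
  one cell wide, and k - K is the depth below it. Every counted point is close to an active grid
  point on level k or k + 1, and each such grid point accounts for boundedly many values.\<close>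

lemma count_coord:
  fixes M X :: real and b :: bool and c :: label
  assumes "K \<le> k" "M \<ge> 0"
  defines "Z \<equiv> {\<lfloor>Y * real N powi (k + 1) * M\<rfloor> | Y \<tau>. \<lfloor>\<tau>\<rfloor> = k \<and> weight b Y \<tau> > 0 \<and>
    lab b Y \<tau> = c \<and> \<bar>Y - X\<bar> * real N powi K \<le> 1}"
  shows "finite Z \<and> real (card Z) \<le>
    2 * ((N + 8) * (1 + N)) * (4 * N * M + 4) * real_of_int (k - K + 2)"
proof -
  define A where "A l = {i. label i l = c \<and>
    (\<forall>j. upn (nat (l - K)) i = Some j \<longrightarrow> \<bar>\<bar>X\<bar> * real N powi K - real j\<bar> < 3)}" for l
  \<comment> \<open>Being active controls only \<bar>Y\<bar>, hence an interval for each sign of Y.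
    The factor s converts from level k or k + 1 to level k + 1.\<close>
  define B where "B i s = {\<lfloor>(real i - 1) * s * M\<rfloor>..\<lfloor>(real i + 1) * s * M\<rfloor>} \<union>
    {\<lfloor>-((real i + 1) * s * M)\<rfloor>..\<lfloor>-((real i - 1) * s * M)\<rfloor>}" for i and s :: real
  define C where "C = (\<lambda>l s. \<Union>i\<in>A l. B i s)"
  have cA: "finite (A l)" "real (card (A l)) \<le> ((N + 8) * (1 + N)) * real_of_int (k - K + 2)" if "l \<in> {k, k + 1}" for l
  proof -
    let ?m = "nat (l - K)"
    show "finite (A l)" unfolding A_def using card_label_set by blast
    have "real (card (A l)) \<le> real ((N + 8) * (1 + N * ?m))"
      unfolding A_def using card_label_set by (simp only: of_nat_le_iff)
    also have "\<dots> \<le> real ((N + 8) * ((1 + N) * nat (k - K + 2)))"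
    proof -
      have "?m + 1 \<le> nat (k - K + 2)" using that assms(1) by auto
      then have "(1 + N) * (?m + 1) \<le> (1 + N) * nat (k - K + 2)" by (rule mult_le_mono2)
      moreover have "1 + N * ?m \<le> (1 + N) * (?m + 1)" by (simp add: algebra_simps)
      ultimately have "1 + N * ?m \<le> (1 + N) * nat (k - K + 2)" by (rule order_trans[rotated])
      then show ?thesis unfolding of_nat_le_iff by (rule mult_le_mono2)
    qed
    also have "\<dots> = ((N + 8) * (1 + N)) * real_of_int (k - K + 2)"
    proof -
      have "real (nat (k - K + 2)) = real_of_int (k - K + 2)" using assms(1) by simp
      then show ?thesis by (simp only: of_nat_mult mult.assoc)
    qed
    finally show "real (card (A l)) \<le> ((N + 8) * (1 + N)) * real_of_int (k - K + 2)" .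
  qed
  have cB: "finite (B i s)" "real (card (B i s)) \<le> 4 * N * M + 4" if s: "s = 1 \<or> s = real N" for i s
  proof -
    have s': "s \<le> real N" "0 \<le> s" using s N_pos by auto
    have le: "(real i - 1) * s * M \<le> (real i + 1) * s * M"
      using s' assms(2) by (intro mult_right_mono) auto
    have "real (card (B i s)) \<le> real (card {\<lfloor>(real i - 1) * s * M\<rfloor>..\<lfloor>(real i + 1) * s * M\<rfloor>}) +
       real (card {\<lfloor>-((real i + 1) * s * M)\<rfloor>..\<lfloor>-((real i - 1) * s * M)\<rfloor>})"
      unfolding B_def of_nat_add[symmetric] of_nat_le_iff by (rule card_Un_le)
    also have "\<dots> \<le> ((real i + 1) * s * M - (real i - 1) * s * M + 2) +
       (-((real i - 1) * s * M) - (-((real i + 1) * s * M)) + 2)"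
      using le by (intro add_mono card_floor_interval) auto
    also have "\<dots> = 4 * (s * M) + 4" by (simp add: algebra_simps)
    also have "\<dots> \<le> 4 * (N * M) + 4" using s' assms(2) by (simp add: mult_right_mono)
    finally show "real (card (B i s)) \<le> 4 * N * M + 4" by (simp only: mult.assoc)
    show "finite (B i s)" by (simp add: B_def)
  qed
  have cC: "finite (C l s) \<and> real (card (C l s)) \<le> ((N + 8) * (1 + N)) * real_of_int (k - K + 2) * (4 * N * M + 4)"
    if "l \<in> {k, k + 1}" "s = 1 \<or> s = real N" for l s
  proof -
    have "real (card (C l s)) \<le> real (\<Sum>i\<in>A l. card (B i s))"
      unfolding C_def of_nat_le_iff using cA that by (intro card_UN_le) auto
    also have "\<dots> \<le> (\<Sum>i\<in>A l. 4 * N * M + 4)" unfolding of_nat_sum using cB that by (intro sum_mono) auto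
    also have "\<dots> = card (A l) * (4 * N * M + 4)" by simp
    also have "\<dots> \<le> ((N + 8) * (1 + N)) * real_of_int (k - K + 2) * (4 * N * M + 4)"
      using cA(2)[OF that(1)] assms(2) by (intro mult_right_mono) auto
    finally show ?thesis using cA cB that by (auto simp: C_def)
  qed
  have sub: "Z \<subseteq> C k (real N) \<union> C (k + 1) 1"
  proof
    fix q assume "q \<in> Z"
    then obtain Y \<tau> where q: "q = \<lfloor>Y * real N powi (k + 1) * M\<rfloor>" "\<lfloor>\<tau>\<rfloor> = k" "weight b Y \<tau> > 0"
      "lab b Y \<tau> = c" "\<bar>Y - X\<bar> * real N powi K \<le> 1" unfolding Z_def by blast
    obtain l i where a: "active b Y \<tau> l i" using active_exists_pos[OF q(3)] by blast
    have l: "l = k \<or> l = k + 1" using a q(2) unfolding active_def by linarith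
    define m where "m = nat (l - K)"
    have lm: "real N powi l = real N ^ m * real N powi K"
    proof -
      have "l = int m + K" using l assms(1) by (auto simp: m_def)
      then show ?thesis using N_pos by (simp add: power_int_add)
    qed
    have z: "\<bar>\<bar>Y\<bar> * real N powi l - real i\<bar> < 1" using a by (simp add: active_def)
    \<comment> \<open>On level K the ancestor is less than 1 away from \<bar>Y\<bar> by
      \<open>upn_dist\<close>, and \<bar>Y\<bar> is at most 1 away from \<bar>X\<bar>.\<close>
    have near: "\<bar>\<bar>X\<bar> * real N powi K - real j\<bar> < 3" if j: "upn m i = Some j" for j
    proof -
      have p: "real N ^ m \<ge> 1" using N_pos by simp
      have "\<bar>real i - real N ^ m * real j\<bar> \<le> real N ^ m - 1" using upn_dist[OF j] .
      then have "\<bar>real N ^ m * (\<bar>Y\<bar> * real N powi K) - real N ^ m * real j\<bar> < real N ^ m * 1"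
        using z unfolding lm by (simp add: mult_ac)
      then have "real N ^ m * \<bar>\<bar>Y\<bar> * real N powi K - real j\<bar> < real N ^ m * 1"
        using p by (simp add: right_diff_distrib[symmetric] abs_mult)
      then have 1: "\<bar>\<bar>Y\<bar> * real N powi K - real j\<bar> < 1" by (rule iffD1[OF mult_less_cancel_left_pos, rotated]) (use p in linarith)
      show ?thesis using abs_abs_diff_scale[of Y K X] 1 q(5) by linarith
    qed
    have "label i l = c" using lab_eq[OF a] q(4) by (simp only:)
    then have iA: "i \<in> A l" unfolding A_def using near[unfolded m_def] by (intro CollectI conjI allI impI)
    define s where "s = (if l = k then real N else 1)"
    have s0: "s > 0" using N_pos by (simp add: s_def)
    have ls: "real N powi (k + 1) = real N powi l * s" 
    proof (cases "l = k")
      case True then show ?thesis using scale_Suc[of k] by (simp add: s_def)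
    next
      case False then show ?thesis using l by (simp add: s_def)
    qed
    have z': "real i - 1 \<le> \<bar>Y\<bar> * real N powi l" "\<bar>Y\<bar> * real N powi l \<le> real i + 1"
      using z by linarith+
    have "(real i - 1) * s * M \<le> (\<bar>Y\<bar> * real N powi l) * s * M" "(\<bar>Y\<bar> * real N powi l) * s * M \<le> (real i + 1) * s * M"
      by (rule mult_right_mono[OF mult_right_mono]; use z' s0 assms(2) in linarith)+
    then have "(real i - 1) * s * M \<le> \<bar>Y\<bar> * real N powi (k + 1) * M" "\<bar>Y\<bar> * real N powi (k + 1) * M \<le> (real i + 1) * s * M"
      unfolding ls by (simp_all only: mult.assoc)
    moreover have "Y * real N powi (k + 1) * M = \<bar>Y\<bar> * real N powi (k + 1) * M \<or>
      Y * real N powi (k + 1) * M = - (\<bar>Y\<bar> * real N powi (k + 1) * M)" by (cases "Y \<ge> 0") auto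
    ultimately have "q \<in> B i s" unfolding q(1) B_def Un_iff atLeastAtMost_iff
      by (elim disjE; simp only: floor_mono neg_le_iff_le simp_thms)
    then show "q \<in> C k (real N) \<union> C (k + 1) 1" using iA l unfolding C_def s_def by (auto split: if_splits)
  qed
  have f: "finite (C k (real N) \<union> C (k + 1) 1)" using cC by simp
  have "real (card Z) \<le> real (card (C k (real N))) + real (card (C (k + 1) 1))"
    unfolding of_nat_add[symmetric] of_nat_le_iff by (rule order_trans[OF card_mono[OF f sub] card_Un_le])
  also have "\<dots> \<le> ((N + 8) * (1 + N)) * real_of_int (k - K + 2) * (4 * N * M + 4) +
      ((N + 8) * (1 + N)) * real_of_int (k - K + 2) * (4 * N * M + 4)"
    using cC by (intro add_mono) simp_all
  also have "\<dots> = 2 * ((N + 8) * (1 + N)) * (4 * N * M + 4) * real_of_int (k - K + 2)"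
    by (simp add: algebra_simps)
  finally show ?thesis using finite_subset[OF sub f] by (intro conjI)
qed

end

section \<open>Half-space coordinates\<close>

text \<open>Inversion in the sphere of radius sqrt 2 around a boundary point e = axis i0 1 of the ball. It
  maps the ball onto the half-space on which the coordinate i0, which is minus the height, is negative.\<close>

definition half_space :: "'n \<Rightarrow> real ^ 'n \<Rightarrow> real ^ 'n" where
  "half_space i0 x = axis i0 1 + (2 / (norm (x - axis i0 1))\<^sup>2) *\<^sub>R (x - axis i0 1)"

definition height :: "'n \<Rightarrow> real ^ 'n \<Rightarrow> real" where
  "height i0 x = (1 - (norm x)\<^sup>2) / (norm (x - axis i0 1))\<^sup>2"

lemma inversion_dist:
  fixes a b :: "'a::real_inner" assumes "a \<noteq> 0" "b \<noteq> 0"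
  shows "(norm ((2 / (norm a)\<^sup>2) *\<^sub>R a - (2 / (norm b)\<^sup>2) *\<^sub>R b))\<^sup>2 =
    4 * (norm (a - b))\<^sup>2 / ((norm a)\<^sup>2 * (norm b)\<^sup>2)"
proof -
  let ?p = "a \<bullet> a" and ?q = "b \<bullet> b" and ?s = "a \<bullet> b"
  have n: "?p \<noteq> 0" "?q \<noteq> 0" using assms by auto
  have "(norm ((2 / (norm a)\<^sup>2) *\<^sub>R a - (2 / (norm b)\<^sup>2) *\<^sub>R b))\<^sup>2 =
     (2 / ?p) * (2 / ?p) * ?p - 2 * ((2 / ?p) * (2 / ?q) * ?s) + (2 / ?q) * (2 / ?q) * ?q"
    unfolding power2_norm_eq_inner by (simp add: inner_diff_left inner_diff_right inner_commute)
  also have "\<dots> = 4 * (?p - 2 * ?s + ?q) / (?p * ?q)" using n by (simp add: field_simps)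
  also have "?p - 2 * ?s + ?q = (norm (a - b))\<^sup>2"
    unfolding power2_norm_eq_inner by (simp add: inner_diff_left inner_diff_right inner_commute)
  finally show ?thesis by (simp add: power2_norm_eq_inner)
qed

text \<open>The threshold 1 + 1/4 is the one reached in \<open>hdist_less_1\<close>.\<close>

lemma cosh_1_gt: "cosh (1::real) > 5 / 4"
proof -
  have "exp (1::real) \<ge> 1 + 1 + 1\<^sup>2 / 2" by (rule exp_lower_Taylor_quadratic) simp
  moreover have "exp (- 1 :: real) > 0" by simp
  ultimately have "exp 1 + exp (- 1 :: real) > 5 / 2" unfolding power_one by linarith
  then show ?thesis by (simp add: cosh_def)
qed

context
  fixes i0 :: "'n::finite" and x :: "real ^ 'n"
  assumes x: "x \<in> hyp_ball"
begin

lemma ball_ne: "x \<noteq> axis i0 1" using x by (auto simp: hyp_ball_def)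

lemma height_pos: "height i0 x > 0"
proof -
  have "(norm x)\<^sup>2 < 1" using x by (simp add: hyp_ball_def power_less_one_iff)
  then show ?thesis using ball_ne by (simp add: height_def)
qed

lemma half_space_i0: "half_space i0 x $ i0 = - height i0 x"
proof -
  let ?n = "(norm (x - axis i0 1))\<^sup>2"
  have n: "?n \<noteq> 0" using ball_ne by simp
  have e: "?n = (norm x)\<^sup>2 - 2 * x $ i0 + 1"
    unfolding power2_norm_eq_inner
    by (simp add: inner_diff_left inner_diff_right inner_commute inner_axis inner_axis_axis)
  have "half_space i0 x $ i0 = 1 + 2 / ?n * (x $ i0 - 1)" by (simp add: half_space_def)
  also have "\<dots> = (?n + 2 * (x $ i0 - 1)) / ?n" using n by (simp add: field_simps)
  also have "?n + 2 * (x $ i0 - 1) = - (1 - (norm x)\<^sup>2)" using e by simp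
  finally show ?thesis unfolding height_def minus_divide_left .
qed

end

context
  fixes i0 :: "'n::finite" and x y :: "real ^ 'n"
  assumes x: "x \<in> hyp_ball" and y: "y \<in> hyp_ball"
begin

text \<open>The usual distance formula of the half-space model; the norm includes the difference of
  heights through the coordinate \<open>i0\<close>.\<close>

lemma cosh_hdist:
  "cosh (hdist x y) = 1 + (norm (half_space i0 x - half_space i0 y))\<^sup>2 / (2 * height i0 x * height i0 y)"
proof -
  let ?e = "axis i0 1"
  have ne: "norm (x - ?e) \<noteq> 0" "norm (y - ?e) \<noteq> 0" using ball_ne[OF x, of i0] ball_ne[OF y, of i0] by auto
  have b: "(norm x)\<^sup>2 < 1" "(norm y)\<^sup>2 < 1" using x y by (simp_all add: hyp_ball_def power_less_one_iff)
  let ?s = "2 * (norm (x - y))\<^sup>2 / ((1 - (norm x)\<^sup>2) * (1 - (norm y)\<^sup>2))"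
  have "?s \<ge> 0" using b by simp
  then have "cosh (hdist x y) = 1 + ?s" unfolding hdist_def by (intro cosh_arcosh_real) simp
  moreover have "(norm (half_space i0 x - half_space i0 y))\<^sup>2 =
      4 * (norm (x - y))\<^sup>2 / ((norm (x - ?e))\<^sup>2 * (norm (y - ?e))\<^sup>2)"
    using inversion_dist[of "x - ?e" "y - ?e"] ne by (simp add: half_space_def)
  moreover have "2 * D / (a * b) = (4 * D / (p * q)) / (2 * (a / p) * (b / q))"
    if "p \<noteq> 0" "q \<noteq> 0" for D a b p q :: real using that by simp
  ultimately show ?thesis using ne unfolding height_def by simp
qed

lemma hdist_nonneg: "hdist x y \<ge> 0"
proof -
  have b: "(norm x)\<^sup>2 < 1" "(norm y)\<^sup>2 < 1" using x y by (simp_all add: hyp_ball_def power_less_one_iff)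
  then show ?thesis unfolding hdist_def by (intro arcosh_nonneg_real) simp
qed

lemma half_space_dist_le:
  assumes "hdist x y \<le> \<rho>"
  shows "(norm (half_space i0 x - half_space i0 y))\<^sup>2 \<le> 2 * height i0 x * height i0 y * (cosh \<rho> - 1)"
proof -
  have "cosh (hdist x y) \<le> cosh \<rho>" using assms hdist_nonneg by (simp add: cosh_real_nonneg_le_iff)
  then have "(norm (half_space i0 x - half_space i0 y))\<^sup>2 / (2 * height i0 x * height i0 y) \<le> cosh \<rho> - 1"
    by (simp add: cosh_hdist)
  then show ?thesis using height_pos[OF x, of i0] height_pos[OF y, of i0]
    by (simp add: pos_divide_le_eq mult_ac)
qed

lemma coord_le_norm: "(half_space i0 x $ i - half_space i0 y $ i)\<^sup>2 \<le> (norm (half_space i0 x - half_space i0 y))\<^sup>2"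
proof -
  have "\<bar>(half_space i0 x - half_space i0 y) $ i\<bar> \<le> norm (half_space i0 x - half_space i0 y)" by (rule component_le_norm_cart)
  then show ?thesis by (simp add: abs_le_square_iff[symmetric])
qed

text \<open>Dropping the horizontal coordinates leaves the distance along a vertical line, where
  cosh (ln s - ln t) = (s^2 + t^2) / (2 s t).\<close>

lemma ln_height_le:
  assumes "hdist x y \<le> \<rho>" shows "\<bar>ln (height i0 x) - ln (height i0 y)\<bar> \<le> \<rho>"
proof -
  let ?s = "height i0 x" and ?t = "height i0 y"
  have p: "?s > 0" "?t > 0" using height_pos x y by blast+
  have "(?s - ?t)\<^sup>2 \<le> 2 * ?s * ?t * (cosh \<rho> - 1)"
    using half_space_dist_le[OF assms] coord_le_norm[of i0] half_space_i0[OF x, of i0] half_space_i0[OF y, of i0]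
    by (simp add: power2_commute)
  then have "?s\<^sup>2 + ?t\<^sup>2 \<le> 2 * ?s * ?t * cosh \<rho>" by (simp add: power2_diff algebra_simps)
  moreover have "2 * ?s * ?t * cosh (ln ?s - ln ?t) = ?s\<^sup>2 + ?t\<^sup>2"
  proof -
    have "cosh (ln ?s - ln ?t) = (?s / ?t + ?t / ?s) / 2"
      using p by (simp add: cosh_def exp_diff)
    then show ?thesis using p by (simp add: field_simps power2_eq_square)
  qed
  ultimately have "cosh (ln ?s - ln ?t) \<le> cosh \<rho>" using p
    by (metis mult_le_cancel_left_pos mult_pos_pos zero_less_numeral)
  then have "cosh \<bar>ln ?s - ln ?t\<bar> \<le> cosh \<rho>" by simp
  moreover have "\<rho> \<ge> 0" using assms hdist_nonneg by linarith
  ultimately show ?thesis by (intro iffD1[OF cosh_real_nonneg_le_iff[OF abs_ge_zero]])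
qed

lemma coord_le:
  assumes "hdist x y \<le> \<rho>" shows "\<bar>half_space i0 x $ i - half_space i0 y $ i\<bar> \<le> exp \<rho> * height i0 x"
proof -
  let ?s = "height i0 x" and ?t = "height i0 y"
  have p: "?s > 0" "?t > 0" using height_pos x y by blast+
  have r: "\<rho> \<ge> 0" using assms hdist_nonneg by linarith
  have "ln ?t \<le> \<rho> + ln ?s" using ln_height_le[OF assms] by linarith
  then have "exp (ln ?t) \<le> exp (\<rho> + ln ?s)" by simp
  then have t: "?t \<le> exp \<rho> * ?s" using p by (simp add: exp_add)
  have "cosh \<rho> - 1 \<le> exp \<rho> / 2"
  proof -
    have "exp (- \<rho>) \<le> 1" using r by simp
    then have "exp \<rho> + exp (- \<rho>) \<le> exp \<rho> + 2" by linarith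
    then show ?thesis by (simp add: cosh_def field_simps)
  qed
  then have "2 * ?s * ?t * (cosh \<rho> - 1) \<le> 2 * ?s * ?t * (exp \<rho> / 2)"
    using p by (intro mult_left_mono) auto
  also have "\<dots> = ?s * exp \<rho> * ?t" by simp
  also have "\<dots> \<le> ?s * exp \<rho> * (exp \<rho> * ?s)" using t p by (intro mult_left_mono) auto
  also have "\<dots> = (exp \<rho> * ?s)\<^sup>2" by (simp add: power2_eq_square)
  finally have "(half_space i0 x $ i - half_space i0 y $ i)\<^sup>2 \<le> (exp \<rho> * ?s)\<^sup>2"
    using half_space_dist_le[OF assms] coord_le_norm[of i] by linarith
  then show ?thesis using p by (simp add: abs_le_square_iff[symmetric])
qed

lemma hdist_less_1:
  fixes \<delta> h :: real
  assumes "\<And>i. \<bar>half_space i0 x $ i - half_space i0 y $ i\<bar> \<le> \<delta>" "height i0 x \<ge> h" "height i0 y \<ge> h" "h > 0"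
    and \<delta>: "CARD('n) * \<delta>\<^sup>2 \<le> h\<^sup>2 / 2"
  shows "hdist x y < 1"
proof -
  let ?s = "height i0 x" and ?t = "height i0 y"
  have "(norm (half_space i0 x - half_space i0 y))\<^sup>2 = (\<Sum>i\<in>UNIV. (half_space i0 x $ i - half_space i0 y $ i)\<^sup>2)"
    by (simp add: norm_vec_def L2_set_def sum_nonneg)
  also have "\<dots> \<le> (\<Sum>i\<in>(UNIV::'n set). \<delta>\<^sup>2)"
    using assms(1) by (intro sum_mono) (metis abs_le_square_iff abs_ge_self order_trans)
  also have "\<dots> \<le> h\<^sup>2 / 2" using \<delta> by simp
  finally have 1: "(norm (half_space i0 x - half_space i0 y))\<^sup>2 \<le> h\<^sup>2 / 2" .
  have "h\<^sup>2 \<le> ?s * ?t" unfolding power2_eq_square using assms by (intro mult_mono) auto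
  then have "(norm (half_space i0 x - half_space i0 y))\<^sup>2 \<le> 1 / 4 * (2 * ?s * ?t)" using 1 by linarith
  moreover have "2 * ?s * ?t > 0" using height_pos[OF x, of i0] height_pos[OF y, of i0] by simp
  ultimately have "(norm (half_space i0 x - half_space i0 y))\<^sup>2 / (2 * ?s * ?t) \<le> 1 / 4"
    by (subst pos_divide_le_eq) auto
  then have "cosh (hdist x y) < cosh 1" using cosh_1_gt unfolding cosh_hdist by linarith
  then show ?thesis using hdist_nonneg by (simp add: cosh_real_nonneg_less_iff)
qed

end

section \<open>The cover\<close>

lemma hdist_commute: "hdist x y = hdist y x"
  by (simp add: hdist_def norm_minus_commute mult.commute)

locale hyp_grid = grid N for N +
  fixes i0 :: "'n::finite" and r :: real and S :: "(real ^ 'n) set"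
  assumes r: "r \<ge> 0" "5 * CARD('n) * r \<le> ln N"
    and S_sub: "S \<subseteq> hyp_ball" and S_sep: "separated_set hdist 1 S"
begin

text \<open>The 5 serves two estimates in \<open>key_near\<close>: 2 \<open>eps\<close> is less than
  the width 1/d of a gap, and \<open>eps\<close> is less than the margin w / 4 of
  \<open>lab_near\<close> for w = 1/d.\<close>

definition eps :: real where "eps = 1 / (5 * CARD('n))"
text \<open>A step of length r moves each coordinate by at most exp r times the height, and the
  height is at most N \<open>sigma\<close> in units of mesh N^(-(lev + 1)). The product of the two
  bounds is \<open>eps\<close>.\<close>

definition sigma :: real where "sigma = eps / (N * exp r)"
definition tau :: "real ^ 'n \<Rightarrow> real" where "tau x = log N (sigma / height i0 x)"
abbreviation lev :: "real ^ 'n \<Rightarrow> int" where "lev x \<equiv> \<lfloor>tau x\<rfloor>"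

lemma eps_pos: "eps > 0" "eps < 1" "eps * (5 * CARD('n)) = 1"
proof -
  have "CARD('n) > 0" by simp
  then have "real CARD('n) \<ge> 1" by linarith
  then have "1 < 5 * real CARD('n)" by linarith
  then show "eps > 0" "eps < 1" "eps * (5 * CARD('n)) = 1" by (auto simp: eps_def)
qed

lemma sigma_pos: "sigma > 0" using eps_pos N_pos by (simp add: sigma_def)

lemma sigma_eps: "exp r * (N * sigma) = eps" using N_pos by (simp add: sigma_def)

lemma sigma_le_1: "sigma \<le> 1"
proof -
  have "1 * 1 \<le> N * exp r" using N_pos r by (intro mult_mono) auto
  then show ?thesis using eps_pos by (simp add: sigma_def divide_le_eq_1)
qed

lemma height_lev:
  assumes "x \<in> hyp_ball"
  shows "sigma < height i0 x * real N powi (lev x + 1)" "height i0 x * real N powi (lev x + 1) \<le> N * sigma"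
proof -
  have h: "height i0 x > 0" using height_pos assms by blast
  have pw: "real N powr tau x = sigma / height i0 x"
    unfolding tau_def using h sigma_pos N_pos by (subst powr_log_cancel) auto
  have pi: "real N powi k = real N powr real_of_int k" for k
    using powr_real_of_int'[of "real N" k] N_pos by simp
  have "sigma / height i0 x < real N powi (lev x + 1)"
    unfolding pw[symmetric] pi using N_pos by (intro powr_less_mono) (auto, linarith?)
  then show "sigma < height i0 x * real N powi (lev x + 1)"
    using h by (simp add: pos_divide_less_eq mult.commute)
  have "real N powi lev x \<le> sigma / height i0 x"
    unfolding pw[symmetric] pi using N_pos by (intro powr_mono) auto
  then have "height i0 x * real N powi lev x \<le> sigma"
    using h by (simp add: pos_le_divide_eq mult.commute)
  then have "N * (height i0 x * real N powi lev x) \<le> N * sigma" by (rule mult_left_mono) simp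
  then show "height i0 x * real N powi (lev x + 1) \<le> N * sigma"
    unfolding scale_Suc by (simp only: mult.left_commute)
qed

lemma ln_N: "ln (real N) \<ge> 1"
proof -
  have "exp (1::real) \<le> 3" by (rule exp_le)
  then have "exp 1 \<le> real N" using N_pos by linarith
  then show ?thesis using N_pos by (subst ln_ge_iff) auto
qed

lemma tau_diff:
  assumes "x \<in> hyp_ball" "y \<in> hyp_ball" "hdist x y \<le> \<rho>"
  shows "\<bar>tau x - tau y\<bar> * ln N \<le> \<rho>"
proof -
  have h: "height i0 x > 0" "height i0 y > 0" using height_pos assms by blast+
  have "tau x - tau y = (ln (height i0 y) - ln (height i0 x)) / ln N"
    unfolding tau_def log_def using h sigma_pos by (simp add: ln_div diff_divide_distrib)
  then have "\<bar>tau x - tau y\<bar> * ln N = \<bar>ln (height i0 x) - ln (height i0 y)\<bar>"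
    using ln_N by (simp add: abs_minus_commute)
  then show ?thesis using ln_height_le[OF assms, of i0] by simp
qed

lemma coord_scaled:
  assumes "x \<in> hyp_ball" "y \<in> hyp_ball" "hdist x y \<le> \<rho>"
  shows "\<bar>half_space i0 x $ i - half_space i0 y $ i\<bar> * real N powi (lev x + 1) \<le> exp \<rho> * (N * sigma)"
proof -
  have "\<bar>half_space i0 x $ i - half_space i0 y $ i\<bar> * real N powi (lev x + 1) \<le>
      (exp \<rho> * height i0 x) * real N powi (lev x + 1)"
    by (rule mult_right_mono[OF coord_le[OF assms] less_imp_le[OF scale_pos]])
  also have "\<dots> = exp \<rho> * (height i0 x * real N powi (lev x + 1))" by (rule mult.assoc)
  also have "\<dots> \<le> exp \<rho> * (N * sigma)"
    by (rule mult_left_mono[OF height_lev(2)[OF assms(1)]]) simp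
  finally show ?thesis .
qed

lemma hdist_close:
  assumes "x \<in> hyp_ball" "y \<in> hyp_ball" "hdist x y \<le> r"
  shows "\<bar>tau x - tau y\<bar> \<le> eps" "\<bar>half_space i0 x $ i - half_space i0 y $ i\<bar> * real N powi (lev x + 1) \<le> eps"
proof -
  have "r \<le> eps * ln N"
    using mult_left_mono[OF r(2) less_imp_le[OF eps_pos(1)]] eps_pos(3)
    by (simp add: mult.assoc[symmetric])
  then have "\<bar>tau x - tau y\<bar> * ln N \<le> eps * ln N" using tau_diff[OF assms] by linarith
  then show "\<bar>tau x - tau y\<bar> \<le> eps" using ln_N by (simp add: mult_le_cancel_right)
  show "\<bar>half_space i0 x $ i - half_space i0 y $ i\<bar> * real N powi (lev x + 1) \<le> eps"
    using coord_scaled[OF assms] sigma_eps by simp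
qed

section \<open>The colours of the cover and their pieces\<close>

abbreviation wt :: "bool \<Rightarrow> 'n \<Rightarrow> real ^ 'n \<Rightarrow> real" where
  "wt b i x \<equiv> weight b (half_space i0 x $ i) (tau x)"

definition fam :: "nat \<Rightarrow> real ^ 'n \<Rightarrow> bool" where
  "fam c x \<longleftrightarrow> (\<forall>i. i \<noteq> i0 \<longrightarrow> wt True i x * CARD('n) < c \<or> wt True i x * CARD('n) \<ge> c + 1)"

definition side :: "nat \<Rightarrow> 'n \<Rightarrow> real ^ 'n \<Rightarrow> bool" where
  "side c i x \<longleftrightarrow> wt True i x * CARD('n) \<ge> c + 1"

definition key :: "nat \<Rightarrow> real ^ 'n \<Rightarrow> 'n \<Rightarrow> bool \<times> label" where
  "key c x = (\<lambda>i. if i = i0 then undefined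
     else (side c i x, lab (side c i x) (half_space i0 x $ i) (tau x)))"

lemma fam_cover: "\<exists>c \<le> CARD('n) - 1. fam c x"
proof -
  let ?f = "\<lambda>i. nat \<lfloor>wt True i x * CARD('n)\<rfloor>"
  have "card (?f ` (UNIV - {i0})) < card {..CARD('n) - 1}"
  proof -
    have "card (?f ` (UNIV - {i0})) \<le> card (UNIV - {i0})" by (rule card_image_le) simp
    also have "\<dots> < card {..CARD('n) - 1}" by (simp add: card_Diff_singleton)
    finally show ?thesis .
  qed
  then have "\<not> {..CARD('n) - 1} \<subseteq> ?f ` (UNIV - {i0})"
    by (metis card_mono finite finite_imageI linorder_not_le)
  then obtain c where c: "c \<le> CARD('n) - 1" "c \<notin> ?f ` (UNIV - {i0})" by blast
  have "fam c x" unfolding fam_def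
  proof (intro allI impI)
    fix i assume "i \<noteq> i0"
    then have ne: "?f i \<noteq> c" using c(2) by blast
    show "wt True i x * CARD('n) < c \<or> wt True i x * CARD('n) \<ge> c + 1"
    proof (rule ccontr)
      assume "\<not> ?thesis"
      then have "\<lfloor>wt True i x * CARD('n)\<rfloor> = int c" by (intro floor_unique) auto
      then show False using ne by simp
    qed
  qed
  then show ?thesis using c(1) by blast
qed

text \<open>Above the gap the weight of True is at least (c + 1)/d; below it the weight of False
  exceeds 1 - c/d, and c \<le> d - 1. Either way the component recorded in \<open>key\<close> is
  entered deeply enough for \<open>lab_near\<close>.\<close>

lemma fam_weight:
  assumes "fam c x" "c \<le> CARD('n) - 1" "i \<noteq> i0"
  shows "wt (side c i x) i x \<ge> 1 / CARD('n)"
proof -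
  have d: "CARD('n) > 0" by simp
  have "wt (side c i x) i x * CARD('n) \<ge> 1"
  proof (cases "side c i x")
    case True
    then show ?thesis by (simp add: side_def)
  next
    case False
    then have "wt True i x * CARD('n) < c" using assms(1,3) by (auto simp: fam_def side_def)
    moreover have "real c + 1 \<le> CARD('n)" using assms(2) d by linarith
    moreover have "wt False i x = 1 - wt True i x" using weight_not[of True] by simp
    ultimately show ?thesis using False by (simp add: left_diff_distrib)
  qed
  then show ?thesis using d by (simp add: divide_le_eq)
qed

lemma key_near:
  assumes x: "x \<in> hyp_ball" "fam c x" and y: "y \<in> hyp_ball" "fam c y"
    and c: "c \<le> CARD('n) - 1" and xy: "hdist x y \<le> r"
  shows "key c x = key c y"
proof -
  have d: "real CARD('n) > 0" by simp
  have yx: "hdist y x \<le> r" using xy by (simp add: hdist_commute)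
  have sl: "side c i x = side c i y \<and> lab (side c i x) (half_space i0 x $ i) (tau x) = lab (side c i x) (half_space i0 y $ i) (tau y)"
    if i: "i \<noteq> i0" for i
  proof
    have "\<bar>wt True i x - wt True i y\<bar> \<le> 2 * eps"
    proof (rule weight_lip[OF hdist_close(1)[OF x(1) y(1) xy] _ eps_pos(2)])
      show "\<bar>half_space i0 x $ i - half_space i0 y $ i\<bar> * real N powi (lev y + 1) \<le> eps"
        using hdist_close(2)[OF y(1) x(1) yx, of i] by (simp only: abs_minus_commute)
    qed
    then have "\<bar>wt True i x - wt True i y\<bar> * CARD('n) \<le> 2 * eps * CARD('n)"
      by (rule mult_right_mono) simp
    also have "2 * eps * CARD('n) < 1" using eps_pos(3) by linarith
    finally have "\<bar>wt True i x * CARD('n) - wt True i y * CARD('n)\<bar> < 1"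
      unfolding abs_diff_scale[OF d] .
    moreover have "wt True i x * CARD('n) < c \<or> wt True i x * CARD('n) \<ge> c + 1"
      "wt True i y * CARD('n) < c \<or> wt True i y * CARD('n) \<ge> c + 1"
      using x(2) y(2) i unfolding fam_def by blast+
    ultimately show "side c i x = side c i y" unfolding side_def by linarith
    have e: "eps < 1 / CARD('n) / 4" using d unfolding eps_def by (simp add: field_simps)
    show "lab (side c i x) (half_space i0 x $ i) (tau x) = lab (side c i x) (half_space i0 y $ i) (tau y)"
      using d
      by (intro lab_near[OF fam_weight[OF x(2) c i] _ le_less_trans[OF hdist_close(1)[OF x(1) y(1) xy] e]
          le_less_trans[OF hdist_close(2)[OF x(1) y(1) xy] e]]) simp
  qed
  show ?thesis unfolding key_def
  proof
    fix i
    show "(if i = i0 then undefined else (side c i x, lab (side c i x) (half_space i0 x $ i) (tau x))) =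
        (if i = i0 then undefined else (side c i y, lab (side c i y) (half_space i0 y $ i) (tau y)))"
      using sl[of i] by (cases "i = i0") auto
  qed
qed

section \<open>Counting the points of a piece in a ball\<close>

definition M :: real where "M = 2 * CARD('n) / sigma"

text \<open>M is large enough for a separated set to have at most one point in each cell.\<close>

definition cell :: "real ^ 'n \<Rightarrow> 'n \<Rightarrow> int" where
  "cell x = (\<lambda>i. \<lfloor>half_space i0 x $ i * real N powi (lev x + 1) * M\<rfloor>)"

lemma M_pos: "M > 0" using sigma_pos by (simp add: M_def)

lemma cell_inj:
  assumes "x \<in> S" "y \<in> S" "lev x = lev y" "cell x = cell y" shows "x = y"
proof (rule ccontr)
  assume "x \<noteq> y"
  then have ge: "hdist x y \<ge> 1" using S_sep assms by (auto simp: separated_set_def)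
  define s where "s = real N powi (lev x + 1)"
  have s: "s > 0" by (simp add: s_def)
  have b: "x \<in> hyp_ball" "y \<in> hyp_ball" using S_sub assms by auto
  have d: "real CARD('n) \<ge> 1" using eps_pos by (simp add: Suc_leI)
  have "hdist x y < 1"
  proof (rule hdist_less_1[OF b, of i0 "1 / (s * M)" "sigma / s"])
    fix i
    have "\<lfloor>half_space i0 x $ i * (s * M)\<rfloor> = \<lfloor>half_space i0 y $ i * (s * M)\<rfloor>"
      using fun_cong[OF assms(4), of i] assms(3) by (simp add: cell_def s_def mult.assoc)
    then have "\<bar>half_space i0 x $ i * (s * M) - half_space i0 y $ i * (s * M)\<bar> \<le> 1" by linarith
    then have "\<bar>half_space i0 x $ i - half_space i0 y $ i\<bar> * (s * M) \<le> 1"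
      using abs_diff_scale[of "s * M"] s M_pos by simp
    then show "\<bar>half_space i0 x $ i - half_space i0 y $ i\<bar> \<le> 1 / (s * M)"
      using s M_pos by (simp add: pos_le_divide_eq)
  next
    show "height i0 x \<ge> sigma / s" "height i0 y \<ge> sigma / s"
      using height_lev(1)[OF b(1)] height_lev(1)[OF b(2)] s assms(3)
      by (simp_all add: s_def pos_divide_le_eq)
    show "sigma / s > 0" using sigma_pos s by simp
    \<comment> \<open>The squared diagonal of a cell, computed from M = 2 d / \<open>sigma\<close>,
      is compared with the squared lower bound \<open>sigma\<close> / s for the heights.\<close>
    have "CARD('n) * (1 / (s * M))\<^sup>2 = (sigma / s)\<^sup>2 / (4 * real CARD('n))"
      using s sigma_pos d by (simp add: M_def field_simps power2_eq_square)
    also have "\<dots> \<le> (sigma / s)\<^sup>2 / 2"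
    proof (rule divide_left_mono)
      show "2 \<le> 4 * real CARD('n)" using d by linarith
    qed (use d in auto)
    finally show "CARD('n) * (1 / (s * M))\<^sup>2 \<le> (sigma / s)\<^sup>2 / 2" .
  qed
  then show False using ge by simp
qed

text \<open>The 1 in \<rho> + 1 pays for rounding to levels. Since exp \<rho> \<le> exp m \<le> N^m,
  the ball moves each coordinate by at most one mesh of the grid m levels above its centre.\<close>

lemma level_range:
  assumes "x \<in> hyp_ball" "y \<in> hyp_ball" "hdist x y \<le> \<rho>" "\<rho> + 1 \<le> real m"
  shows "\<bar>lev x - lev y\<bar> \<le> int m"
    and "\<bar>half_space i0 y $ i - half_space i0 x $ i\<bar> * real N powi (lev x - int m) \<le> 1"
proof -
  have "\<bar>tau x - tau y\<bar> * 1 \<le> \<bar>tau x - tau y\<bar> * ln N" using ln_N by (intro mult_left_mono) auto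
  then have "\<bar>tau x - tau y\<bar> * 1 \<le> \<rho>" using tau_diff[OF assms(1-3)] by (rule order_trans)
  then have "\<bar>tau x - tau y\<bar> \<le> \<rho>" by simp
  then show "\<bar>lev x - lev y\<bar> \<le> int m" using assms(4) by linarith
  have "exp \<rho> \<le> exp (real m * 1)" using assms(4) by simp
  also have "\<dots> = exp 1 ^ m" by (rule exp_of_nat_mult)
  also have "\<dots> \<le> real N ^ m" using exp_le N_pos by (intro power_mono) auto
  finally have e: "exp \<rho> \<le> real N ^ m" .
  let ?a = "\<bar>half_space i0 y $ i - half_space i0 x $ i\<bar>"
  have "real N powi (lev x + 1) = real N powi (lev x - int m) * (real N ^ m * N)"
  proof -
    have "lev x + 1 = (lev x - int m) + int (Suc m)" by simp
    then show ?thesis using N_pos by (metis power_int_add power_int_of_nat power_Suc2)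
  qed
  then have "?a * real N powi (lev x - int m) * (real N ^ m * N) = ?a * real N powi (lev x + 1)"
    by (simp only: mult.assoc)
  also have "\<dots> \<le> exp \<rho> * (N * sigma)"
    using coord_scaled[OF assms(1-3), of i] by (simp only: abs_minus_commute)
  also have "\<dots> \<le> real N ^ m * (N * 1)"
    using e mult_left_mono[OF sigma_le_1, of "real N"] sigma_pos by (intro mult_mono) auto
  finally have "?a * real N powi (lev x - int m) * (real N ^ m * N) \<le> 1 * (real N ^ m * N)" by simp
  then show "?a * real N powi (lev x - int m) \<le> 1" by (rule mult_right_le_imp_le) (use N_pos in simp)
qed

definition piece :: "nat \<Rightarrow> ('n \<Rightarrow> bool \<times> label) \<Rightarrow> (real ^ 'n) set" where
  "piece c \<kappa> = {y \<in> S. fam c y \<and> key c y = \<kappa>}"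

definition Q :: real where "Q = 2 * ((N + 8) * (1 + N)) * (4 * N * M + 4)"

text \<open>Bounds the values of the vertical coordinate of \<open>cell\<close>, uniformly over all
  levels, since the rescaled height lies between 0 and N \<open>sigma\<close>.\<close>

definition Q0 :: nat where "Q0 = card {\<lfloor>- (N * sigma * M)\<rfloor>..0}"

text \<open>By \<open>cell_inj\<close> it suffices to count pairs (level, cell). The level gives one
  factor linear in m, each of the d - 1 horizontal coordinates another, and the vertical one a
  constant.\<close>

lemma piece_count:
  assumes c: "c \<le> CARD('n) - 1" and x: "x \<in> piece c \<kappa>" and \<rho>: "\<rho> + 1 \<le> real m"
  shows "finite {y \<in> piece c \<kappa>. hdist x y \<le> \<rho>} \<and>
    real (card {y \<in> piece c \<kappa>. hdist x y \<le> \<rho>}) \<le> Q0 * Q ^ (CARD('n) - 1) * real (2 * m + 2) ^ CARD('n)"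
proof -
  let ?T = "{y \<in> piece c \<kappa>. hdist x y \<le> \<rho>}"
  let ?d = "CARD('n)"
  have xb: "x \<in> hyp_ball" using x S_sub by (auto simp: piece_def)
  define K where "K = lev x - int m"
  define Z where "Z i k = {\<lfloor>Y * real N powi (k + 1) * M\<rfloor> | Y \<tau>. \<lfloor>\<tau>\<rfloor> = k \<and> weight (fst (\<kappa> i)) Y \<tau> > 0 \<and>
    lab (fst (\<kappa> i)) Y \<tau> = snd (\<kappa> i) \<and> \<bar>Y - half_space i0 x $ i\<bar> * real N powi K \<le> 1}" for i k
  define J where "J k = (\<Pi>\<^sub>E i\<in>UNIV. if i = i0 then {\<lfloor>- (N * sigma * M)\<rfloor>..0} else Z i k)" for k
  define R where "R = {lev x - int m..lev x + int m}"
  have Q_nonneg: "Q \<ge> 0" using M_pos by (simp add: Q_def)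
  have Z: "finite (Z i k) \<and> real (card (Z i k)) \<le> Q * (2 * m + 2)" if k: "k \<in> R" for i k
  proof -
    have Kk: "K \<le> k" using k by (simp add: K_def R_def)
    have "finite (Z i k) \<and> real (card (Z i k)) \<le> Q * real_of_int (k - K + 2)"
      using count_coord[OF Kk less_imp_le[OF M_pos], of "fst (\<kappa> i)" "snd (\<kappa> i)" "half_space i0 x $ i"]
      unfolding Z_def Q_def .
    moreover have "Q * real_of_int (k - K + 2) \<le> Q * (2 * m + 2)"
      using k Q_nonneg by (intro mult_left_mono) (auto simp: K_def R_def)
    ultimately show ?thesis by linarith
  qed
  have J: "finite (J k) \<and> real (card (J k)) \<le> Q0 * (Q * (2 * m + 2)) ^ (?d - 1)" if k: "k \<in> R" for k
  proof
    show "finite (J k)" unfolding J_def using Z[OF k] by (intro finite_PiE) auto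
    have "real (card (J k)) = (\<Prod>i\<in>UNIV. real (card (if i = i0 then {\<lfloor>- (N * sigma * M)\<rfloor>..0} else Z i k)))"
      unfolding J_def by (simp add: card_PiE)
    also have "\<dots> = real Q0 * (\<Prod>i\<in>UNIV - {i0}. real (card (if i = i0 then {\<lfloor>- (N * sigma * M)\<rfloor>..0} else Z i k)))"
      by (subst prod.remove[of _ i0]) (simp_all add: Q0_def)
    also have "(\<Prod>i\<in>UNIV - {i0}. real (card (if i = i0 then {\<lfloor>- (N * sigma * M)\<rfloor>..0} else Z i k)))
        \<le> (\<Prod>i\<in>UNIV - {i0}. Q * (2 * m + 2))"
      using Z[OF k] by (intro prod_mono) auto
    also have "\<dots> = (Q * (2 * m + 2)) ^ (?d - 1)" by (simp add: card_Diff_singleton)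
    finally show "real (card (J k)) \<le> Q0 * (Q * (2 * m + 2)) ^ (?d - 1)"
      by (simp add: mult_left_mono)
  qed
  have sub: "(\<lambda>y. (lev y, cell y)) ` ?T \<subseteq> Sigma R J"
  proof (rule image_subsetI)
    fix y assume "y \<in> ?T"
    then have y: "y \<in> S" "fam c y" "key c y = \<kappa>" "hdist x y \<le> \<rho>" by (auto simp: piece_def)
    have yb: "y \<in> hyp_ball" using y S_sub by auto
    have "lev y \<in> R" using level_range(1)[OF xb yb y(4) \<rho>] by (auto simp: R_def)
    moreover have "cell y \<in> J (lev y)" unfolding J_def
    proof (rule PiE_I)
      fix i :: 'n
      show "cell y i \<in> (if i = i0 then {\<lfloor>- (N * sigma * M)\<rfloor>..0} else Z i (lev y))"
      proof (cases "i = i0")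
        case True
        define h where "h = height i0 y * real N powi (lev y + 1)"
        have h: "0 \<le> h * M" "h * M \<le> N * sigma * M"
          using height_lev[OF yb] sigma_pos M_pos by (auto simp: h_def)
        have "cell y i = \<lfloor>- (h * M)\<rfloor>" unfolding cell_def True half_space_i0[OF yb] h_def by simp
        moreover have "\<lfloor>- (N * sigma * M)\<rfloor> \<le> \<lfloor>- (h * M)\<rfloor>" using h(2) by (intro floor_mono) simp
        moreover have "\<lfloor>- (h * M)\<rfloor> \<le> 0" using h(1) by (simp add: floor_le_iff)
        ultimately show ?thesis using True by simp
      next
        case False
        have k: "fst (\<kappa> i) = side c i y" "snd (\<kappa> i) = lab (side c i y) (half_space i0 y $ i) (tau y)"
          using y(3) False by (auto simp: key_def)
        have "wt (side c i y) i y > 0"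
          using fam_weight[OF y(2) c False] by (rule less_le_trans[rotated]) simp
        then have "cell y i \<in> Z i (lev y)" unfolding Z_def cell_def k K_def
          using level_range(2)[OF xb yb y(4) \<rho>, of i] by blast
        then show ?thesis using False by simp
      qed
    qed simp
    ultimately show "(lev y, cell y) \<in> Sigma R J" by blast
  qed
  have inj: "inj_on (\<lambda>y. (lev y, cell y)) ?T"
    by (rule inj_onI) (auto simp: piece_def intro: cell_inj)
  have fR: "finite (Sigma R J)" using J by (intro finite_SigmaI) (auto simp: R_def)
  have fin: "finite ?T" using finite_subset[OF sub fR] inj by (rule finite_imageD)
  have "card ?T = card ((\<lambda>y. (lev y, cell y)) ` ?T)" by (rule card_image[OF inj, symmetric])
  also have "\<dots> \<le> card (Sigma R J)" by (rule card_mono[OF fR sub])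
  also have "\<dots> = (\<Sum>k\<in>R. card (J k))" using J by (intro card_SigmaI) (auto simp: R_def)
  finally have "real (card ?T) \<le> (\<Sum>k\<in>R. real (card (J k)))" by (simp flip: of_nat_sum)
  also have "\<dots> \<le> (\<Sum>k\<in>R. Q0 * (Q * (2 * m + 2)) ^ (?d - 1))" using J by (intro sum_mono) auto
  also have "\<dots> = real (2 * m + 1) * (Q0 * (Q * (2 * m + 2)) ^ (?d - 1))" by (simp add: R_def)
  also have "\<dots> \<le> real (2 * m + 2) * (Q0 * (Q * (2 * m + 2)) ^ (?d - 1))"
    using Q_nonneg by (intro mult_right_mono) auto
  also have "\<dots> = Q0 * Q ^ (?d - 1) * (real (2 * m + 2) * real (2 * m + 2) ^ (?d - 1))"
    by (simp add: power_mult_distrib mult_ac)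
  also have "real (2 * m + 2) * real (2 * m + 2) ^ (?d - 1) = real (2 * m + 2) ^ ?d"
    by (simp flip: power_Suc)
  finally show ?thesis using fin by blast
qed

lemma piece_growth:
  "\<exists>C. \<forall>c\<le>CARD('n) - 1. \<forall>\<kappa>. \<forall>x\<in>piece c \<kappa>. \<forall>\<rho>\<ge>0. finite {y \<in> piece c \<kappa>. hdist x y \<le> \<rho>} \<and>
    real (card {y \<in> piece c \<kappa>. hdist x y \<le> \<rho>}) \<le> C * \<rho> ^ CARD('n) + C"
proof (intro exI allI impI ballI)
  let ?d = "CARD('n)"
  let ?A = "Q0 * Q ^ (?d - 1)"
  fix c \<kappa> x and \<rho> :: real
  assume c: "c \<le> ?d - 1" and x: "x \<in> piece c \<kappa>" and \<rho>: "0 \<le> \<rho>"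
  define m where "m = nat \<lceil>\<rho>\<rceil> + 1"
  have m: "\<rho> + 1 \<le> real m" "real m \<le> \<rho> + 2" using \<rho> unfolding m_def by linarith+
  have A: "?A \<ge> 0" using M_pos by (simp add: Q_def)
  \<comment> \<open>The left side is at most 2 \<rho> + 6. The maximum covers small radii, which end
    up in the additive constant.\<close>
  have "real (2 * m + 2) \<le> 12 * max \<rho> 1" using m by (auto simp: max_def)
  then have "real (2 * m + 2) ^ ?d \<le> (12 * max \<rho> 1) ^ ?d" by (rule power_mono) simp
  also have "\<dots> = 12 ^ ?d * max \<rho> 1 ^ ?d" by (rule power_mult_distrib)
  also have "\<dots> \<le> 12 ^ ?d * (\<rho> ^ ?d + 1)" using \<rho> by (intro mult_left_mono) (auto simp: max_def)
  finally have "?A * real (2 * m + 2) ^ ?d \<le> ?A * (12 ^ ?d * (\<rho> ^ ?d + 1))"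
    using A by (rule mult_left_mono)
  also have "\<dots> = ?A * 12 ^ ?d * \<rho> ^ ?d + ?A * 12 ^ ?d" by (simp add: distrib_left mult.assoc)
  finally show "finite {y \<in> piece c \<kappa>. hdist x y \<le> \<rho>} \<and>
      real (card {y \<in> piece c \<kappa>. hdist x y \<le> \<rho>}) \<le> ?A * 12 ^ ?d * \<rho> ^ ?d + ?A * 12 ^ ?d"
    using piece_count[OF c x m(1)] by linarith
qed

lemma poly_cover:
  "\<exists>U :: nat \<Rightarrow> (real ^ 'n) set set. S = (\<Union>c\<le>CARD('n) - 1. \<Union>(U c)) \<and>
     (\<forall>c\<le>CARD('n) - 1. \<forall>P\<in>U c. \<forall>P'\<in>U c. P \<noteq> P' \<longrightarrow>
       P \<inter> P' = {} \<and> (\<forall>x\<in>P. \<forall>y\<in>P'. hdist x y \<ge> r)) \<and>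
     (\<exists>C::real. \<forall>c\<le>CARD('n) - 1. \<forall>P\<in>U c. \<forall>x\<in>P. \<forall>\<rho>::real. \<rho> \<ge> 0 \<longrightarrow>
       finite {y\<in>P. hdist x y \<le> \<rho>} \<and>
       real (card {y\<in>P. hdist x y \<le> \<rho>}) \<le> C * \<rho> ^ CARD('n) + C)"
\<comment> \<open>Keys that do not occur all give the empty piece, for which every condition is
  vacuous.\<close>
proof (intro exI[of _ "\<lambda>c. range (piece c)"] conjI)
  show "S = (\<Union>c\<le>CARD('n) - 1. \<Union>(range (piece c)))"
    using fam_cover by (fastforce simp: piece_def)
  show "\<forall>c\<le>CARD('n) - 1. \<forall>P\<in>range (piece c). \<forall>P'\<in>range (piece c). P \<noteq> P' \<longrightarrow>
      P \<inter> P' = {} \<and> (\<forall>x\<in>P. \<forall>y\<in>P'. hdist x y \<ge> r)"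
  proof (intro allI impI ballI)
    fix c P P' assume c: "c \<le> CARD('n) - 1" and P: "P \<in> range (piece c)" "P' \<in> range (piece c)" "P \<noteq> P'"
    then obtain \<kappa> \<kappa>' where k: "P = piece c \<kappa>" "P' = piece c \<kappa>'" "\<kappa> \<noteq> \<kappa>'" by blast
    have "hdist x y \<ge> r" if xy: "x \<in> P" "y \<in> P'" for x y
    proof (rule ccontr)
      assume "\<not> ?thesis"
      moreover have "x \<in> hyp_ball" "y \<in> hyp_ball" "fam c x" "fam c y" "key c x = \<kappa>" "key c y = \<kappa>'"
        using xy S_sub by (auto simp: k piece_def)
      ultimately show False using key_near[of x c y] c k(3) by simp
    qed
    then show "P \<inter> P' = {} \<and> (\<forall>x\<in>P. \<forall>y\<in>P'. hdist x y \<ge> r)"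
      using k by (auto simp: piece_def)
  qed
  obtain C where "\<forall>c\<le>CARD('n) - 1. \<forall>\<kappa>. \<forall>x\<in>piece c \<kappa>. \<forall>\<rho>\<ge>0. finite {y \<in> piece c \<kappa>. hdist x y \<le> \<rho>} \<and>
    real (card {y \<in> piece c \<kappa>. hdist x y \<le> \<rho>}) \<le> C * \<rho> ^ CARD('n) + C"
    using piece_growth by blast
  then show "\<exists>C::real. \<forall>c\<le>CARD('n) - 1. \<forall>P\<in>range (piece c). \<forall>x\<in>P. \<forall>\<rho>::real. \<rho> \<ge> 0 \<longrightarrow>
       finite {y\<in>P. hdist x y \<le> \<rho>} \<and>
       real (card {y\<in>P. hdist x y \<le> \<rho>}) \<le> C * \<rho> ^ CARD('n) + C"
    by (intro exI[of _ C]) auto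
qed

end

theorem theoremE:
  fixes S :: "(real ^ 'n) set"
  assumes "CARD('n) \<ge> 2"
    and "maximal_separated_subset hdist 1 hyp_ball S"
  shows "asdim_poly CARD('n) hdist S \<le> enat (CARD('n) - 1)"
proof -
  have S: "S \<subseteq> hyp_ball" "separated_set hdist 1 S"
    using assms(2) by (auto simp: maximal_separated_subset_def)
  have w: "asdim_poly_witness hdist S CARD('n) (CARD('n) - 1)"
    unfolding asdim_poly_witness_def
  proof (intro allI impI)
    fix r :: real assume r: "r \<ge> 0"
    define N where "N = nat \<lceil>exp (5 * CARD('n) * r)\<rceil> + 3"
    have "exp (5 * CARD('n) * r) \<le> real N" unfolding N_def by linarith
    moreover have "real N > 0" unfolding N_def of_nat_add by linarith
    ultimately have "5 * CARD('n) * r \<le> ln N" by (simp add: ln_ge_iff)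
    moreover have "N \<ge> 3" by (simp add: N_def)
    \<comment> \<open>Any coordinate can play the role of the vertical one.\<close>
    ultimately interpret hyp_grid N "undefined :: 'n" r S
      using r S by unfold_locales
    show "\<exists>U. S = (\<Union>i\<le>CARD('n) - 1. \<Union> (U i)) \<and>
        (\<forall>i\<le>CARD('n) - 1. \<forall>P\<in>U i. \<forall>Q\<in>U i. P \<noteq> Q \<longrightarrow> P \<inter> Q = {} \<and> (\<forall>x\<in>P. \<forall>y\<in>Q. r \<le> hdist x y)) \<and>
        (\<exists>C. \<forall>i\<le>CARD('n) - 1. \<forall>P\<in>U i. \<forall>x\<in>P. \<forall>\<rho>\<ge>0. finite {y \<in> P. hdist x y \<le> \<rho>} \<and>
          real (card {y \<in> P. hdist x y \<le> \<rho>}) \<le> C * \<rho> ^ CARD('n) + C)"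
      by (rule poly_cover)
  qed
  then have "asdim_poly CARD('n) hdist S = enat (LEAST n. asdim_poly_witness hdist S CARD('n) n)"
    unfolding asdim_poly_def by auto
  also have "\<dots> \<le> enat (CARD('n) - 1)" using w by (simp add: Least_le)
  finally show ?thesis .
qed

end
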